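(* Let $(s,t)\in\{(-1,0),(0,1)\}$ and, for real $\delta$, let $\hat W_{s,t}(\delta)$ be the $8\times 8$ matrix defined in the context (built from the Hadamard coin). The eigenvalues of $\hat W_{s,t}(\delta)$ close to the unit circle in the complex plane are $$1-\frac{\delta^2}{4}+o(\delta^2),\qquad 1+\frac{i}{\sqrt3}\delta-\frac29\delta^2+o(\delta^2),\qquad 1-\frac{i}{\sqrt3}\delta-\frac29\delta^2+o(\delta^2)$$ as $\delta\to0$. The corresponding perturbed eigenprojections of these three eigenvalues converge to $v_1v_1^*$, $v_2v_2^*$ and $v_3v_3^*$, respectively, as $\delta\to 0$, where $$v_1=\left(-\tfrac12,0,0,-\tfrac12,\tfrac12,0,0,\tfrac12\right)^\top,$$ $$v_2=\frac{1}{\sqrt{12(2-\sqrt3)}}\,(2-\sqrt3,\,0,\,1-\sqrt3,\,1,\,2-\sqrt3,\,1-\sqrt3,\,0,\,1)^\top,$$ $$v_3=\frac{1}{\sqrt{12(2+\sqrt3)}}\,(2+\sqrt3,\,0,\,1+\sqrt3,\,1,\,2+\sqrt3,\,1+\sqrt3,\,0,\,1)^\top.$$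
   Context: Let $H=\frac1{\sqrt2}\begin{bmatrix}1&1\\1&-1\end{bmatrix}$, $|L\rangle=[1\;0]^\top$, $|R\rangle=[0\;1]^\top$, $P=H|L\rangle\langle L|$, $Q=H|R\rangle\langle R|$; bars denote entrywise complex conjugation. The basis of $\mathbb C^4=\mathbb C^2\otimes\mathbb C^2$ is ordered $|LL\rangle,|LR\rangle,|RL\rangle,|RR\rangle$. For $k\in\mathbb R$ put $V(k)=e^{-ik}(P\otimes\bar P)+e^{ik}(Q\otimes\bar Q)$ and let $\hat U(k)$ be the operator on $\ell^2(\mathbb Z;\mathbb C^4)$ given by $$(\hat U(k)\hat\phi)(v)=(P\otimes\bar Q)\hat\phi(v+1)+(Q\otimes\bar P)\hat\phi(v-1)+V(k)\hat\phi(v).$$ For integers $s\le 0\le t$ let $\chi_{s,t}:\ell^2(\mathbb Z;\mathbb C^4)\to\ell^2(\{s,\dots,t\};\mathbb C^4)$ be the restriction and $\hat W_{s,t}(k)=\chi_{s,t}\hat U(k)\chi_{s,t}^*$. For $t-s=1$, ordering the basis as $(s;LL),(s;LR),(s;RL),(s;RR),(t;LL),(t;LR),(t;RL),(t;RR)$, $$\hat W_{s,t}(k)=\begin{bmatrix}V(k)&P\otimes\bar Q\\ Q\otimes\bar P&V(k)\end{bmatrix}.$$ "Eigenvalues close to the unit circle" are those whose modulus tends to $1$ as $\delta\to0$. The eigenprojection of an eigenvalue is the (not necessarily orthogonal) spectral projection onto its generalized eigenspace along the sum of the other generalized eigenspaces. *)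

theory Defs
  imports
    "HOL-Library.Landau_Symbols"
    "Jordan_Normal_Form.Char_Poly"
    "Jordan_Normal_Form.Matrix_Kernel"
begin

definition outer_prod :: "complex vec \<Rightarrow> complex vec \<Rightarrow> complex mat" where
  "outer_prod u w = mat (dim_vec u) (dim_vec w) (\<lambda>(i, j). u $ i * cnj (w $ j))"

definition conj_mat :: "complex mat \<Rightarrow> complex mat" where
  "conj_mat A = map_mat cnj A"

text \<open>For \<open>2 \<times> 2\<close> factors the index of the product is \<open>2 * a + b\<close>, which is the
  ordering \<open>LL, LR, RL, RR\<close> of the basis of \<open>\<complex>\<^sup>2 \<otimes> \<complex>\<^sup>2\<close> (with \<open>L = 0\<close>, \<open>R = 1\<close>).\<close>

definition kron :: "complex mat \<Rightarrow> complex mat \<Rightarrow> complex mat" where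
  "kron A B = mat (dim_row A * dim_row B) (dim_col A * dim_col B)
     (\<lambda>(i, j). A $$ (i div dim_row B, j div dim_col B) * B $$ (i mod dim_row B, j mod dim_col B))"

definition hadamard :: "complex mat" where
  "hadamard = complex_of_real (1 / sqrt 2) \<cdot>\<^sub>m mat_of_rows_list 2 [[1, 1], [1, -1]]"

definition ketL :: "complex vec" where "ketL = vec_of_list [1, 0]"

definition ketR :: "complex vec" where "ketR = vec_of_list [0, 1]"

definition coinP :: "complex mat" where "coinP = hadamard * outer_prod ketL ketL"

definition coinQ :: "complex mat" where "coinQ = hadamard * outer_prod ketR ketR"

definition V_mat :: "real \<Rightarrow> complex mat" where
  "V_mat k = exp (- \<i> * of_real k) \<cdot>\<^sub>m kron coinP (conj_mat coinP)
       + exp (\<i> * of_real k) \<cdot>\<^sub>m kron coinQ (conj_mat coinQ)"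

text \<open>\<open>\<ell>\<^sup>2(\<int>; \<complex>\<^sup>4)\<close> consists of sequences of vectors of dimension 4.  The pointwise
  formula for the operator makes sense for every such sequence; below it is only applied
  to finitely supported ones, so square summability plays no role.\<close>

definition U_hat :: "real \<Rightarrow> (int \<Rightarrow> complex vec) \<Rightarrow> (int \<Rightarrow> complex vec)" where
  "U_hat k \<phi> = (\<lambda>v. kron coinP (conj_mat coinQ) *\<^sub>v \<phi> (v + 1)
                  + kron coinQ (conj_mat coinP) *\<^sub>v \<phi> (v - 1)
                  + V_mat k *\<^sub>v \<phi> v)"

text \<open>\<open>\<ell>\<^sup>2({s,\<dots>,t}; \<complex>\<^sup>4)\<close> is identified with \<open>\<complex>\<^sup>N\<close>, \<open>N = 4 (t - s + 1)\<close>, by listing the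
  sites \<open>s,\<dots>,t\<close> in increasing order and the four components \<open>LL, LR, RL, RR\<close> within each
  site.  Thus \<open>chi s t\<close> is restriction and \<open>chi_adj s t\<close> is extension by zero.\<close>

definition window_dim :: "int \<Rightarrow> int \<Rightarrow> nat" where
  "window_dim s t = 4 * nat (t - s + 1)"

definition chi :: "int \<Rightarrow> int \<Rightarrow> (int \<Rightarrow> complex vec) \<Rightarrow> complex vec" where
  "chi s t \<phi> = vec (window_dim s t) (\<lambda>n. \<phi> (s + int (n div 4)) $ (n mod 4))"

definition chi_adj :: "int \<Rightarrow> int \<Rightarrow> complex vec \<Rightarrow> (int \<Rightarrow> complex vec)" where
  "chi_adj s t \<psi> = (\<lambda>v. if s \<le> v \<and> v \<le> t then vec 4 (\<lambda>j. \<psi> $ (4 * nat (v - s) + j)) else 0\<^sub>v 4)"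

definition W_hat :: "int \<Rightarrow> int \<Rightarrow> real \<Rightarrow> complex mat" where
  "W_hat s t k = mat_of_cols (window_dim s t)
     (map (\<lambda>j. chi s t (U_hat k (chi_adj s t (unit_vec (window_dim s t) j)))) [0..<window_dim s t])"

lemma kron_dims [simp]:
  "dim_row (kron A B) = dim_row A * dim_row B" "dim_col (kron A B) = dim_col A * dim_col B"
  by (simp_all add: kron_def)

lemma coin_dims [simp]:
  "dim_row coinP = 2" "dim_col coinP = 2" "dim_row coinQ = 2" "dim_col coinQ = 2"
  by (simp_all add: coinP_def coinQ_def hadamard_def outer_prod_def ketL_def ketR_def
      mat_of_rows_list_def)

lemma conj_mat_dims [simp]:
  "dim_row (conj_mat A) = dim_row A" "dim_col (conj_mat A) = dim_col A"
  by (simp_all add: conj_mat_def)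

lemma V_mat_dims [simp]: "dim_row (V_mat k) = 4" "dim_col (V_mat k) = 4"
  by (simp_all add: V_mat_def)

lemma mult_unit_vec_index:
  fixes A :: "complex mat"
  assumes "i < dim_row A" "j < n" "dim_col A = n"
  shows "(A *\<^sub>v unit_vec n j) $ i = A $$ (i, j)"
  using assms scalar_prod_right_unit[of j n "row A i"] by (auto simp: row_def)

lemma mult_zero_vec_index:
  fixes A :: "complex mat"
  assumes "i < dim_row A" "dim_col A = n"
  shows "(A *\<^sub>v 0\<^sub>v n) $ i = 0"
  using assms by (auto simp: scalar_prod_def)

lemma chi_adj_unit:
  assumes "j < 8"
  shows "chi_adj s (s + 1) (unit_vec 8 j) v =
    (if v = s + int (j div 4) then unit_vec 4 (j mod 4) else 0\<^sub>v 4)"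
proof (rule eq_vecI)
  fix i assume "i < dim_vec (if v = s + int (j div 4) then unit_vec 4 (j mod 4) else 0\<^sub>v 4 :: complex vec)"
  then have i: "i < 4" by (simp split: if_splits)
  have "v < s \<or> s + 1 < v \<or> v = s \<or> v = s + 1" by linarith
  define q b where "q = j div 4" and "b = j mod 4"
  have b: "b < 4" by (simp add: b_def)
  have j_eq: "j = 4 * q + b" by (simp add: q_def b_def)
  have q: "q = 0 \<or> q = 1" using assms by (auto simp: q_def)
  have "chi_adj s (s + 1) (unit_vec 8 j) v $ i =
    (if v = s + int q then unit_vec 4 b else 0\<^sub>v 4) $ i"
    using \<open>v < s \<or> s + 1 < v \<or> v = s \<or> v = s + 1\<close> q
    by (elim disjE) (use i b in \<open>simp_all add: chi_adj_def unit_vec_def j_eq\<close>)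
  then show "chi_adj s (s + 1) (unit_vec 8 j) v $ i =
    (if v = s + int (j div 4) then unit_vec 4 (j mod 4) else 0\<^sub>v 4) $ i"
    by (simp only: q_def b_def)
qed (simp add: chi_adj_def)

lemma mult_if_unit_vec_index:
  fixes A :: "complex mat"
  assumes "a < dim_row A" "b < n" "dim_col A = n"
  shows "(A *\<^sub>v (if c then unit_vec n b else 0\<^sub>v n)) $ a = (if c then A $$ (a, b) else 0)"
  using assms mult_unit_vec_index[of a A b n] mult_zero_vec_index[of a A n] by (cases c) auto

lemma W_hat_block:
  "W_hat s (s + 1) k =
     four_block_mat (V_mat k) (kron coinP (conj_mat coinQ)) (kron coinQ (conj_mat coinP)) (V_mat k)"
  (is "_ = ?B")
proof (rule eq_matI)
  have N: "window_dim s (s + 1) = 8" by (simp add: window_dim_def)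
  fix i j
  assume "i < dim_row ?B" and "j < dim_col ?B"
  then have i: "i < 8" and j: "j < 8" by simp_all
  define p a q b where "p = i div 4" and "a = i mod 4" and "q = j div 4" and "b = j mod 4"
  have a: "a < 4" and b: "b < 4" by (simp_all add: a_def b_def)
  have i_eq: "i = 4 * p + a" and j_eq: "j = 4 * q + b" by (simp_all add: p_def a_def q_def b_def)
  have p: "p = 0 \<or> p = 1" and q: "q = 0 \<or> q = 1" using i j by (auto simp: p_def q_def)
  have W: "W_hat s (s + 1) k $$ (i, j) =
    U_hat k (chi_adj s (s + 1) (unit_vec 8 j)) (s + int p) $ a"
    using i j unfolding W_hat_def N by (simp add: mat_of_cols_index chi_def N p_def a_def)
  have "U_hat k (chi_adj s (s + 1) (unit_vec 8 j)) (s + int p) $ a =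
      (if s + int p + 1 = s + int q then kron coinP (conj_mat coinQ) $$ (a, b) else 0)
    + (if s + int p - 1 = s + int q then kron coinQ (conj_mat coinP) $$ (a, b) else 0)
    + (if s + int p = s + int q then V_mat k $$ (a, b) else 0)"
    unfolding U_hat_def chi_adj_unit[OF j] q_def[symmetric] b_def[symmetric]
    by (subst index_add_vec, use a in simp)+
       (use a b in \<open>simp del: index_mult_mat_vec add: mult_if_unit_vec_index\<close>)
  moreover have "?B $$ (i, j) =
      (if p = 0 then if q = 0 then V_mat k $$ (a, b) else kron coinP (conj_mat coinQ) $$ (a, b)
       else if q = 0 then kron coinQ (conj_mat coinP) $$ (a, b) else V_mat k $$ (a, b))"
    using i j a b p q by (auto simp: i_eq j_eq)
  ultimately show "W_hat s (s + 1) k $$ (i, j) = ?B $$ (i, j)"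
    using p q unfolding W by (elim disjE) simp_all
qed (simp_all add: W_hat_def window_dim_def)

definition gen_eigenspace :: "complex mat \<Rightarrow> complex \<Rightarrow> complex vec set" where
  "gen_eigenspace A \<mu> = (\<Union>m. mat_kernel (char_matrix A \<mu> ^\<^sub>m m))"

text \<open>Since \<open>\<complex>\<^sup>n\<close> is the direct sum of the generalized eigenspaces, these conditions determine
  \<open>E\<close> uniquely as the (in general oblique) projection onto the generalized eigenspace of
  \<open>\<mu>\<close> along the sum of the other ones.\<close>

definition is_eigenprojection :: "complex mat \<Rightarrow> complex \<Rightarrow> complex mat \<Rightarrow> bool" where
  "is_eigenprojection A \<mu> E \<longleftrightarrow>
     E \<in> carrier_mat (dim_row A) (dim_row A) \<and>
     (\<forall>x \<in> gen_eigenspace A \<mu>. E *\<^sub>v x = x) \<and>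
     (\<forall>\<nu>. eigenvalue A \<nu> \<and> \<nu> \<noteq> \<mu> \<longrightarrow> (\<forall>x \<in> gen_eigenspace A \<nu>. E *\<^sub>v x = 0\<^sub>v (dim_row A)))"

text \<open>A family of eigenvalues close to the unit circle.  The filter \<open>at 0\<close> is punctured:
  the value at \<open>\<delta> = 0\<close>, where the eigenvalue 1 is degenerate, is irrelevant.\<close>

definition eigenvalue_near_circle :: "(real \<Rightarrow> complex mat) \<Rightarrow> (real \<Rightarrow> complex) \<Rightarrow> bool" where
  "eigenvalue_near_circle A \<mu> \<longleftrightarrow>
     (\<forall>\<^sub>F \<delta> in at 0. eigenvalue (A \<delta>) (\<mu> \<delta>)) \<and> ((\<lambda>\<delta>. cmod (\<mu> \<delta>)) \<longlongrightarrow> 1) (at 0)"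

definition eigenprojections_tendsto ::
    "(real \<Rightarrow> complex mat) \<Rightarrow> (real \<Rightarrow> complex) \<Rightarrow> complex mat \<Rightarrow> bool" where
  "eigenprojections_tendsto A \<mu> L \<longleftrightarrow>
     (\<exists>E. (\<forall>\<^sub>F \<delta> in at 0. is_eigenprojection (A \<delta>) (\<mu> \<delta>) (E \<delta>)) \<and>
          (\<forall>\<^sub>F \<delta> in at 0. E \<delta> \<in> carrier_mat (dim_row L) (dim_col L)) \<and>
          (\<forall>i < dim_row L. \<forall>j < dim_col L. ((\<lambda>\<delta>. E \<delta> $$ (i, j)) \<longlongrightarrow> L $$ (i, j)) (at 0)))"

definition v1 :: "complex vec" where
  "v1 = vec_of_list [-1/2, 0, 0, -1/2, 1/2, 0, 0, 1/2]"

definition v2 :: "complex vec" where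
  "v2 = complex_of_real (1 / sqrt (12 * (2 - sqrt 3))) \<cdot>\<^sub>v
     vec_of_list (map complex_of_real
       [2 - sqrt 3, 0, 1 - sqrt 3, 1, 2 - sqrt 3, 1 - sqrt 3, 0, 1])"

definition v3 :: "complex vec" where
  "v3 = complex_of_real (1 / sqrt (12 * (2 + sqrt 3))) \<cdot>\<^sub>v
     vec_of_list (map complex_of_real
       [2 + sqrt 3, 0, 1 + sqrt 3, 1, 2 + sqrt 3, 1 + sqrt 3, 0, 1])"

end

theory Submission
  imports Defs "HOL-Real_Asymp.Real_Asymp"
begin

text \<open>
  The window matrix commutes with exchanging the two tensor factors and the two sites at the same
  time, so it splits into an even and an odd part.  On the part of parity \<open>\<epsilon> = \<plusminus>1\<close> the nonzero
  eigenvalues are the roots of \<open>2\<mu>\<^sup>3 - (2 cos \<delta> + \<epsilon>) \<mu>\<^sup>2 + \<epsilon>\<close>.  At \<open>\<delta> = 0\<close> this cubic is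
  \<open>(\<mu> - 1) (2\<mu>\<^sup>2 + \<mu> + 1)\<close> for odd and \<open>(\<mu> - 1)\<^sup>2 (2\<mu> + 1)\<close> for even parity.  In the even case the
  simple real root \<open>r\<close> near \<open>-1/2\<close> is followed first; Vieta's formulas then express the
  complex pair near \<open>1\<close> through \<open>r\<close>.  For \<open>\<delta> \<noteq> 0\<close> the three roots near \<open>1\<close> are simple
  eigenvalues, so each eigenprojection is the rank one matrix built from a right and a left
  eigenvector.  Their limits are determined by that of \<open>y = (b - \<mu>) / (\<mu> - a)\<close> with
  \<open>a = exp (-\<i>\<delta>)\<close>, \<open>b = exp (\<i>\<delta>)\<close>, which is read off from the first order term of \<open>\<mu>\<close>.
\<close>

section \<open>The window matrix\<close>

lemma forall_less_8: "(\<forall>i<8. P i) \<longleftrightarrow> P 0 \<and> P 1 \<and> P 2 \<and> P 3 \<and> P 4 \<and> P 5 \<and> P 6 \<and> P (7::nat)"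
  by (auto simp: eval_nat_numeral All_less_Suc)

lemma sum_less_8: "sum f {0..<8} = f 0 + f 1 + f 2 + f 3 + f 4 + f 5 + f 6 + f (7::nat)"
  by (simp add: eval_nat_numeral add.assoc)

text \<open>The phases stay free parameters, so that the spectral analysis is polynomial algebra
  that needs of them only \<open>a * b = 1\<close> and, for simplicity of eigenvalues,
  \<open>a \<noteq> b\<close>. Columns 1 and 6 vanish because the components \<open>(s;LR)\<close>
  and \<open>(t;RL)\<close> are shifted out of the window.\<close>

definition window_mat :: "complex \<Rightarrow> complex \<Rightarrow> complex mat" where
  "window_mat a b = (1 / 2) \<cdot>\<^sub>m mat_of_rows_list 8
    [[a, 0, 0,  b, 0,  1, 0, 0],
     [a, 0, 0, -b, 0, -1, 0, 0],
     [a, 0, 0, -b, 0,  1, 0, 0],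
     [a, 0, 0,  b, 0, -1, 0, 0],
     [0, 0,  1, 0, a, 0, 0,  b],
     [0, 0,  1, 0, a, 0, 0, -b],
     [0, 0, -1, 0, a, 0, 0, -b],
     [0, 0, -1, 0, a, 0, 0,  b]]"

lemma window_mat_carrier [simp]: "window_mat a b \<in> carrier_mat 8 8"
  by (rule carrier_matI) (simp_all add: window_mat_def mat_of_rows_list_def)

lemma window_mat_dims [simp]: "dim_row (window_mat a b) = 8" "dim_col (window_mat a b) = 8"
  using window_mat_carrier[of a b] by blast+

lemma coinP_index: "i < 2 \<Longrightarrow> j < 2 \<Longrightarrow> coinP $$ (i, j) = (if j = 0 then 1 / complex_of_real (sqrt 2) else 0)"
  by (auto simp: coinP_def hadamard_def outer_prod_def ketL_def mat_of_rows_list_def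
      scalar_prod_def less_2_cases_iff)

lemma coinQ_index: "i < 2 \<Longrightarrow> j < 2 \<Longrightarrow> coinQ $$ (i, j) =
    (if j = 0 then 0 else if i = 0 then 1 / complex_of_real (sqrt 2) else - 1 / complex_of_real (sqrt 2))"
  by (auto simp: coinQ_def hadamard_def outer_prod_def ketR_def mat_of_rows_list_def
      scalar_prod_def less_2_cases_iff)

lemma of_real_sqrt2_square: "complex_of_real (sqrt 2) * complex_of_real (sqrt 2) = 2"
  by (simp flip: of_real_mult)

text \<open>Each product of coins first projects onto one basis state, so a single column survives:
  LL, RR, LR and RL in turn. The modulus 1/2 comes from two factors \<open>1 / sqrt 2\<close>, and
  every output R of a \<open>coinQ\<close> factor contributes a sign.\<close>

lemma kron_coin_index:
  assumes "i < 4" "j < 4"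
  shows "kron coinP (conj_mat coinP) $$ (i, j) = (if j = 0 then 1 / 2 else 0)"
    and "kron coinQ (conj_mat coinQ) $$ (i, j) =
      (if j = 3 then if i = 0 \<or> i = 3 then 1 / 2 else - 1 / 2 else 0)"
    and "kron coinP (conj_mat coinQ) $$ (i, j) =
      (if j = 1 then if i = 0 \<or> i = 2 then 1 / 2 else - 1 / 2 else 0)"
    and "kron coinQ (conj_mat coinP) $$ (i, j) = (if j = 2 then if i < 2 then 1 / 2 else - 1 / 2 else 0)"
proof -
  have *: "i = 0 \<or> i = 1 \<or> i = 2 \<or> i = 3" "j = 0 \<or> j = 1 \<or> j = 2 \<or> j = 3" using assms by auto
  note entries = kron_def conj_mat_def coinP_index coinQ_index of_real_sqrt2_square
  show "kron coinP (conj_mat coinP) $$ (i, j) = (if j = 0 then 1 / 2 else 0)"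
    using * by (elim disjE) (simp_all add: entries)
  show "kron coinQ (conj_mat coinQ) $$ (i, j) =
      (if j = 3 then if i = 0 \<or> i = 3 then 1 / 2 else - 1 / 2 else 0)"
    using * by (elim disjE) (simp_all add: entries)
  show "kron coinP (conj_mat coinQ) $$ (i, j) =
      (if j = 1 then if i = 0 \<or> i = 2 then 1 / 2 else - 1 / 2 else 0)"
    using * by (elim disjE) (simp_all add: entries)
  show "kron coinQ (conj_mat coinP) $$ (i, j) = (if j = 2 then if i < 2 then 1 / 2 else - 1 / 2 else 0)"
    using * by (elim disjE) (simp_all add: entries)
qed

lemma W_hat_window_mat:
  "W_hat s (s + 1) k = window_mat (exp (- \<i> * of_real k)) (exp (\<i> * of_real k))"
proof (rule eq_matI)
  let ?a = "exp (- \<i> * complex_of_real k)" and ?b = "exp (\<i> * complex_of_real k)"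
  have V: "V_mat k $$ (i, j) = (if j = 0 then ?a / 2
      else if j = 3 then if i = 0 \<or> i = 3 then ?b / 2 else - ?b / 2 else 0)"
    if "i < 4" "j < 4" for i j
    using that by (simp add: V_mat_def kron_coin_index)
  have "\<forall>i<8. \<forall>j<8. W_hat s (s + 1) k $$ (i, j) = window_mat ?a ?b $$ (i, j)"
    unfolding forall_less_8 W_hat_block
    by (simp add: V kron_coin_index window_mat_def mat_of_rows_list_def)
  then show "\<And>i j. i < dim_row (window_mat ?a ?b) \<Longrightarrow> j < dim_col (window_mat ?a ?b) \<Longrightarrow>
      W_hat s (s + 1) k $$ (i, j) = window_mat ?a ?b $$ (i, j)"
    by simp
qed (simp_all add: W_hat_block)

lemma window_mat_mult:
  assumes "x \<in> carrier_vec 8"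
  shows "window_mat a b *\<^sub>v x = (1 / 2) \<cdot>\<^sub>v vec_of_list
    [a * x $ 0 + b * x $ 3 + x $ 5, a * x $ 0 - b * x $ 3 - x $ 5,
     a * x $ 0 - b * x $ 3 + x $ 5, a * x $ 0 + b * x $ 3 - x $ 5,
     a * x $ 4 + b * x $ 7 + x $ 2, a * x $ 4 - b * x $ 7 + x $ 2,
     a * x $ 4 - b * x $ 7 - x $ 2, a * x $ 4 + b * x $ 7 - x $ 2]" (is "_ = ?r")
proof (rule eq_vecI)
  have "\<forall>i<8. (window_mat a b *\<^sub>v x) $ i = ?r $ i"
    unfolding forall_less_8 using assms
    by (simp add: window_mat_def mat_of_rows_list_def scalar_prod_def sum_less_8 vec_of_list_index
        algebra_simps del: vec_of_list_Cons)
  then show "\<And>i. i < dim_vec ?r \<Longrightarrow> (window_mat a b *\<^sub>v x) $ i = ?r $ i"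
    by (simp del: index_mult_mat_vec)
qed simp

section \<open>Simple eigenvalues and their eigenprojections\<close>

text \<open>Pairing with the left eigenvector \<open>z\<close> turns powers of
  \<open>A - \<nu>\<close> into powers of \<open>\<mu> - \<nu>\<close>, so \<open>z\<close>
  annihilates every generalized eigenspace with \<nu> \<noteq> \<mu>. Together with
  \<open>z \<bullet> x \<noteq> 0\<close> the same pairing excludes Jordan chains of length two at
  \<mu>, which confines that generalized eigenspace to the line of \<open>x\<close>. The product is
  bilinear, hence no conjugates.\<close>

lemma rank_one_eigenprojection:
  assumes A: "A \<in> carrier_mat n n" and x: "x \<in> carrier_vec n" and z: "z \<in> carrier_vec n"
    and left: "\<And>u. u \<in> carrier_vec n \<Longrightarrow> z \<bullet> (A *\<^sub>v u) = \<mu> * (z \<bullet> u)"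
    and ker: "\<And>u. u \<in> carrier_vec n \<Longrightarrow> A *\<^sub>v u = \<mu> \<cdot>\<^sub>v u \<Longrightarrow> \<exists>\<alpha>. u = \<alpha> \<cdot>\<^sub>v x"
    and zx: "z \<bullet> x \<noteq> 0"
  shows "is_eigenprojection A \<mu> (mat n n (\<lambda>(i, j). x $ i * z $ j / (z \<bullet> x)))"
    (is "is_eigenprojection A \<mu> ?E")
proof -
  have C: "char_matrix A \<nu> \<in> carrier_mat n n" for \<nu>
    using A by (simp add: char_matrix_def)
  have Cmul: "char_matrix A \<nu> *\<^sub>v u = A *\<^sub>v u - \<nu> \<cdot>\<^sub>v u" if "u \<in> carrier_vec n" for \<nu> u
    using A that by (intro eq_vecI)
      (auto simp: char_matrix_def add_mult_distrib_mat_vec[where nr = n and nc = n])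
  have Cpow: "(char_matrix A \<nu> ^\<^sub>m m) *\<^sub>v u \<in> carrier_vec n" if "u \<in> carrier_vec n" for \<nu> m u
    using C[of \<nu>] that by (meson mult_mat_vec_carrier pow_carrier_mat)
  \<comment> \<open>A factor is split off next to the vector; the inductions on \<open>m\<close>
    below therefore generalize over \<open>u\<close>.\<close>
  have Csuc: "(char_matrix A \<nu> ^\<^sub>m Suc m) *\<^sub>v u = (char_matrix A \<nu> ^\<^sub>m m) *\<^sub>v (char_matrix A \<nu> *\<^sub>v u)"
    if "u \<in> carrier_vec n" for \<nu> m u
    using assoc_mult_mat_vec[OF pow_carrier_mat[OF C] C that] by simp
  have zC: "z \<bullet> (char_matrix A \<nu> *\<^sub>v u) = (\<mu> - \<nu>) * (z \<bullet> u)" if "u \<in> carrier_vec n" for \<nu> u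
    using that A z left[OF that]
    by (simp add: Cmul scalar_prod_minus_distrib[where n = n] algebra_simps)
  have zCpow: "z \<bullet> ((char_matrix A \<nu> ^\<^sub>m m) *\<^sub>v u) = (\<mu> - \<nu>) ^ m * (z \<bullet> u)"
    if "u \<in> carrier_vec n" for \<nu> m u
    using that
  proof (induction m arbitrary: u)
    case 0
    then show ?case using C[of \<nu>] by simp
  next
    case (Suc m)
    then show ?case
      using C[of \<nu>] by (simp add: Csuc zC mult_mat_vec_carrier[OF C] del: pow_mat.simps)
  qed
  have E: "?E *\<^sub>v u = (z \<bullet> u / (z \<bullet> x)) \<cdot>\<^sub>v x" if "u \<in> carrier_vec n" for u
    using that x z by (intro eq_vecI)
      (auto simp: scalar_prod_def sum_distrib_left sum_divide_distrib sum_distrib_right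
        intro!: sum.cong)
  have memD: "u \<in> carrier_vec n \<and> (\<exists>m. (char_matrix A \<nu> ^\<^sub>m m) *\<^sub>v u = 0\<^sub>v n)"
    if "u \<in> gen_eigenspace A \<nu>" for u \<nu>
    using that mat_kernelD[OF pow_carrier_mat[OF C]] unfolding gen_eigenspace_def by blast
  have fixed: "\<exists>\<alpha>. u = \<alpha> \<cdot>\<^sub>v x" if "u \<in> carrier_vec n" "(char_matrix A \<mu> ^\<^sub>m m) *\<^sub>v u = 0\<^sub>v n" for u m
    using that
  proof (induction m arbitrary: u)
    case 0
    then have "u = 0 \<cdot>\<^sub>v x" using C[of \<mu>] A x by (auto simp: char_matrix_def)
    then show ?case by blast
  next
    case (Suc m)
    let ?w = "char_matrix A \<mu> *\<^sub>v u"
    have w: "?w \<in> carrier_vec n" using Suc.prems(1) mult_mat_vec_carrier[OF C] by blast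
    then obtain \<beta> where \<beta>: "?w = \<beta> \<cdot>\<^sub>v x"
      using Suc.IH[of ?w] Suc.prems by (auto simp: Csuc simp del: pow_mat.simps)
    \<comment> \<open>\<open>z\<close> annihilates the range of \<open>A - \<mu>\<close>, and
      \<open>\<beta> \<cdot>\<^sub>v x\<close> lies in it.\<close>
    have "\<beta> * (z \<bullet> x) = 0"
      using zC[OF Suc.prems(1), of \<mu>] x z unfolding \<beta> by simp
    then have "?w = 0\<^sub>v n" using \<beta> zx x by auto
    then have *: "A *\<^sub>v u - \<mu> \<cdot>\<^sub>v u = 0\<^sub>v n" using Cmul Suc.prems(1) by simp
    have "A *\<^sub>v u = \<mu> \<cdot>\<^sub>v u"
    proof (rule eq_vecI)
      fix i assume "i < dim_vec (\<mu> \<cdot>\<^sub>v u)"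
      then show "(A *\<^sub>v u) $ i = (\<mu> \<cdot>\<^sub>v u) $ i"
        using arg_cong[OF *, of "\<lambda>v. v $ i"] Suc.prems(1) A by simp
    qed (use A Suc.prems(1) in simp)
    then show ?case using ker Suc.prems(1) by blast
  qed
  show ?thesis
    unfolding is_eigenprojection_def
  proof (intro conjI ballI allI impI)
    show "?E \<in> carrier_mat (dim_row A) (dim_row A)" using A by simp
  next
    fix u assume "u \<in> gen_eigenspace A \<mu>"
    then obtain \<alpha> where "u = \<alpha> \<cdot>\<^sub>v x" "u \<in> carrier_vec n" using memD fixed by blast
    then show "?E *\<^sub>v u = u" using E zx x z by simp
  next
    fix \<nu> u assume \<nu>: "eigenvalue A \<nu> \<and> \<nu> \<noteq> \<mu>" and "u \<in> gen_eigenspace A \<nu>"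
    then obtain m where u: "u \<in> carrier_vec n" "(char_matrix A \<nu> ^\<^sub>m m) *\<^sub>v u = 0\<^sub>v n"
      using memD by blast
    then have "z \<bullet> u = 0" using zCpow[OF u(1), of \<nu> m] \<nu> z by auto
    then show "?E *\<^sub>v u = 0\<^sub>v (dim_row A)" using E[OF u(1)] A x by auto
  qed
qed

section \<open>Eigenvector equations and their parity decomposition\<close>

lemma window_mat_eigenvector_iff:
  assumes "x \<in> carrier_vec 8"
  shows "window_mat a b *\<^sub>v x = \<mu> \<cdot>\<^sub>v x \<longleftrightarrow>
    a * x $ 0 + b * x $ 3 + x $ 5 = 2 * \<mu> * x $ 0 \<and>
    a * x $ 0 - b * x $ 3 - x $ 5 = 2 * \<mu> * x $ 1 \<and>
    a * x $ 0 - b * x $ 3 + x $ 5 = 2 * \<mu> * x $ 2 \<and>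
    a * x $ 0 + b * x $ 3 - x $ 5 = 2 * \<mu> * x $ 3 \<and>
    a * x $ 4 + b * x $ 7 + x $ 2 = 2 * \<mu> * x $ 4 \<and>
    a * x $ 4 - b * x $ 7 + x $ 2 = 2 * \<mu> * x $ 5 \<and>
    a * x $ 4 - b * x $ 7 - x $ 2 = 2 * \<mu> * x $ 6 \<and>
    a * x $ 4 + b * x $ 7 - x $ 2 = 2 * \<mu> * x $ 7"
proof -
  have half: "p / 2 = \<mu> * q \<longleftrightarrow> p = 2 * \<mu> * q" for p q :: complex by (auto simp: field_simps)
  have "window_mat a b *\<^sub>v x = \<mu> \<cdot>\<^sub>v x \<longleftrightarrow>
      (\<forall>i<8. (window_mat a b *\<^sub>v x) $ i = (\<mu> \<cdot>\<^sub>v x) $ i)"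
    using assms by (auto simp: vec_eq_iff simp del: index_mult_mat_vec)
  then show ?thesis
    unfolding window_mat_mult[OF assms] forall_less_8
    using assms by (simp add: vec_of_list_index half mult_ac del: vec_of_list_Cons)
qed

text \<open>A multiple of the characteristic polynomial of the part of parity \<open>\<epsilon>\<close>, divided by \<open>\<mu>\<close>;
  the constraint \<open>a * b = 1\<close> has been used to simplify the coefficients.\<close>

definition parity_poly :: "complex \<Rightarrow> complex \<Rightarrow> complex \<Rightarrow> complex \<Rightarrow> complex" where
  "parity_poly \<epsilon> a b \<mu> = 2 * \<mu> ^ 3 - (a + b + \<epsilon>) * \<mu>\<^sup>2 + \<epsilon>"

text \<open>The symmetry exchanges the indices 0, 2, 3 with 4, 5, 7, and the three sums are the
  coordinates of the part of parity \<epsilon>. They satisfy a closed system of three linear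
  equations whose determinant is a nonzero multiple of \<open>parity_poly\<close>.\<close>

lemma parity_component_zero:
  assumes "x \<in> carrier_vec 8" "window_mat a b *\<^sub>v x = \<mu> \<cdot>\<^sub>v x"
    and "\<epsilon> * \<epsilon> = 1" "a * b = 1" and "parity_poly \<epsilon> a b \<mu> \<noteq> 0"
  shows "x $ 0 + \<epsilon> * x $ 4 = 0" "x $ 2 + \<epsilon> * x $ 5 = 0" "x $ 3 + \<epsilon> * x $ 7 = 0"
proof -
  define y0 y2 y3 where "y0 = x $ 0 + \<epsilon> * x $ 4" and "y2 = x $ 2 + \<epsilon> * x $ 5"
    and "y3 = x $ 3 + \<epsilon> * x $ 7"
  note eqs = assms(2)[unfolded window_mat_eigenvector_iff[OF assms(1)]]
  have ee: "\<epsilon> * (\<epsilon> * c) = c" for c using assms(3) by (simp flip: mult.assoc)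
  have comb: "p + \<epsilon> * q = 2 * \<mu> * (u + \<epsilon> * v)" if "p = 2 * \<mu> * u" "q = 2 * \<mu> * v" for p q u v
    by (simp add: that algebra_simps)
  have E1: "a * y0 + b * y3 + \<epsilon> * y2 = 2 * \<mu> * y0"
    unfolding y0_def y2_def y3_def
    by (rule trans[OF _ comb[OF eqs[THEN conjunct1]
          eqs[THEN conjunct2, THEN conjunct2, THEN conjunct2, THEN conjunct2, THEN conjunct1]]])
       (simp add: ee algebra_simps)
  have E2: "a * y0 - b * y3 + \<epsilon> * y2 = 2 * \<mu> * y2"
    unfolding y0_def y2_def y3_def
    by (rule trans[OF _ comb[OF eqs[THEN conjunct2, THEN conjunct2, THEN conjunct1]
          eqs[THEN conjunct2, THEN conjunct2, THEN conjunct2, THEN conjunct2, THEN conjunct2,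
            THEN conjunct1]]])
       (simp add: ee algebra_simps)
  have E3: "a * y0 + b * y3 - \<epsilon> * y2 = 2 * \<mu> * y3"
    unfolding y0_def y2_def y3_def
    by (rule trans[OF _ comb[OF eqs[THEN conjunct2, THEN conjunct2, THEN conjunct2, THEN conjunct1]
          eqs[THEN conjunct2, THEN conjunct2, THEN conjunct2, THEN conjunct2, THEN conjunct2,
            THEN conjunct2, THEN conjunct2]]])
       (simp add: ee algebra_simps)
  \<comment> \<open>Half the difference of \<open>E1\<close> and \<open>E3\<close> expresses
    \<open>y2\<close> by the other two unknowns, half their sum is free of \<open>y2\<close>;
    inserting \<open>y2\<close> into \<open>E2\<close> then leaves a two by two system for
    \<open>y0\<close> and \<open>y3\<close>.\<close>
  have "2 * (\<epsilon> * y2) = (a * y0 + b * y3 + \<epsilon> * y2) - (a * y0 + b * y3 - \<epsilon> * y2)" by simp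
  also have "\<dots> = 2 * (\<mu> * (y0 - y3))" unfolding E1 E3 by (simp add: algebra_simps)
  finally have "\<epsilon> * y2 = \<mu> * (y0 - y3)" by simp
  from arg_cong[OF this, of "\<lambda>c. \<epsilon> * c"]
  have y2: "y2 = \<epsilon> * (\<mu> * (y0 - y3))" by (simp add: ee)
  have "2 * (a * y0 + b * y3) = (a * y0 + b * y3 + \<epsilon> * y2) + (a * y0 + b * y3 - \<epsilon> * y2)" by simp
  also have "\<dots> = 2 * (\<mu> * (y0 + y3))" unfolding E1 E3 by (simp add: algebra_simps)
  finally have "a * y0 + b * y3 = \<mu> * (y0 + y3)" by (simp del: distrib_left_numeral)
  then have e1: "(\<mu> - a) * y0 = - ((\<mu> - b) * y3)" by (simp add: algebra_simps)
  \<comment> \<open>The coefficient of \<open>y0 - y3\<close> in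
    \<open>2 * \<mu> * y2 - \<epsilon> * y2\<close> after \<open>y2\<close> is eliminated.\<close>
  define T where "T = 2 * \<epsilon> * \<mu>\<^sup>2 - \<mu>"
  have "(T - a) * y0 - (T - b) * y3 = (2 * \<mu> * y2 - \<epsilon> * y2) - (a * y0 - b * y3)"
    unfolding y2 T_def by (simp add: ee algebra_simps power2_eq_square)
  also have "\<dots> = 0" unfolding E2[symmetric] by simp
  finally have e2: "(T - a) * y0 = (T - b) * y3" by simp
  \<comment> \<open>Up to sign the determinant of the system \<open>e1\<close>, \<open>e2\<close>;
    the products with \<open>y0\<close> and \<open>y3\<close> below are Cramer's rule.\<close>
  define d where "d = (\<mu> - a) * (T - b) + (\<mu> - b) * (T - a)"
  have d: "d = 2 * \<epsilon> * parity_poly \<epsilon> a b \<mu>"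
    using assms(3,4) unfolding d_def T_def parity_poly_def
    by (simp add: ee algebra_simps power2_eq_square power3_eq_cube)
  have "d * y0 = (T - b) * ((\<mu> - a) * y0) + (\<mu> - b) * ((T - a) * y0)"
    by (simp add: d_def algebra_simps)
  then have "d * y0 = 0" unfolding e1 e2 by (simp add: algebra_simps)
  moreover have "d * y3 = (\<mu> - a) * ((T - b) * y3) - (T - a) * (- ((\<mu> - b) * y3))"
    by (simp add: d_def algebra_simps)
  then have "d * y3 = 0" unfolding e1[symmetric] e2[symmetric] by (simp add: algebra_simps)
  moreover have "d \<noteq> 0" using d assms(3,5) by auto
  ultimately have "y0 = 0" "y3 = 0" by simp_all
  moreover from this have "y2 = 0" using y2 by simp
  ultimately show "x $ 0 + \<epsilon> * x $ 4 = 0" "x $ 2 + \<epsilon> * x $ 5 = 0" "x $ 3 + \<epsilon> * x $ 7 = 0"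
    by (simp_all add: y0_def y2_def y3_def)
qed

text \<open>If neither cubic vanishes, an eigenvector has no part of either parity except in entries
  1 and 6. Rows 1 and 6 express these through the other entries after division by
  \<open>2 * \<mu>\<close>. The basis vectors 1 and 6 lie in the kernel, hence the exclusion of
  \<mu> = 0.\<close>

lemma eigenvalue_window_mat_imp:
  assumes "eigenvalue (window_mat a b) \<mu>" "\<mu> \<noteq> 0" "a * b = 1"
  shows "parity_poly 1 a b \<mu> = 0 \<or> parity_poly (- 1) a b \<mu> = 0"
proof (rule ccontr)
  assume neg: "\<not> ?thesis"
  obtain x where x: "x \<in> carrier_vec 8" "x \<noteq> 0\<^sub>v 8" "window_mat a b *\<^sub>v x = \<mu> \<cdot>\<^sub>v x"
    using assms(1) by (auto simp: eigenvalue_def eigenvector_def)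
  note plus = parity_component_zero[OF x(1,3), of 1] and minus = parity_component_zero[OF x(1,3), of "- 1"]
  have sum_diff: "u = 0 \<and> v = 0" if "u + 1 * v = 0" "u + - 1 * v = 0" for u v :: complex
    using that by (simp add: eq_neg_iff_add_eq_0[symmetric])
  have "x $ 0 = 0 \<and> x $ 4 = 0" "x $ 2 = 0 \<and> x $ 5 = 0" "x $ 3 = 0 \<and> x $ 7 = 0"
    by (rule sum_diff; (intro plus minus; (use neg assms(3) in simp)))+
  moreover from this have "x $ 1 = 0" "x $ 6 = 0"
    using x(3) assms(2) unfolding window_mat_eigenvector_iff[OF x(1)] by auto
  ultimately have "\<forall>i<8. x $ i = 0" unfolding forall_less_8 by simp
  then show False using x(1,2) by (auto simp: vec_eq_iff)
qed

text \<open>The right and left eigenvectors of parity \<open>\<epsilon>\<close>, scaled to have entries \<open>1\<close> and \<open>b\<close> at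
  \<open>(s; RR)\<close>, when \<open>y = (b - \<mu>) / (\<mu> - a)\<close>.\<close>

definition right_vec :: "complex \<Rightarrow> complex \<Rightarrow> complex \<Rightarrow> complex \<Rightarrow> complex \<Rightarrow> complex vec" where
  "right_vec \<epsilon> a b \<mu> y = vec_of_list
    [y, (a * y - b - \<mu> * (y - 1)) / (2 * \<mu>), \<epsilon> * \<mu> * (y - 1), 1,
     \<epsilon> * y, \<mu> * (y - 1), \<epsilon> * (a * y - b - \<mu> * (y - 1)) / (2 * \<mu>), \<epsilon>]"

definition left_vec :: "complex \<Rightarrow> complex \<Rightarrow> complex \<Rightarrow> complex \<Rightarrow> complex \<Rightarrow> complex vec" where
  "left_vec \<epsilon> a b \<mu> y = vec_of_list
    [a * y, 0, \<mu> * (y - 1), b, \<epsilon> * a * y, \<epsilon> * \<mu> * (y - 1), 0, \<epsilon> * b]"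

lemma right_left_vec_carrier [simp]:
  "right_vec \<epsilon> a b \<mu> y \<in> carrier_vec 8" "left_vec \<epsilon> a b \<mu> y \<in> carrier_vec 8"
  by (rule carrier_vecI, simp add: right_vec_def left_vec_def del: vec_of_list_Cons)+

lemma dim_right_vec [simp]: "dim_vec (right_vec \<epsilon> a b \<mu> y) = 8"
  by (rule carrier_vecD) simp

lemma right_vec_index:
  "right_vec \<epsilon> a b \<mu> y $ 0 = y"
  "right_vec \<epsilon> a b \<mu> y $ 1 = (a * y - b - \<mu> * (y - 1)) / (2 * \<mu>)"
  "right_vec \<epsilon> a b \<mu> y $ 2 = \<epsilon> * \<mu> * (y - 1)"
  "right_vec \<epsilon> a b \<mu> y $ 3 = 1"
  "right_vec \<epsilon> a b \<mu> y $ 4 = \<epsilon> * y"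
  "right_vec \<epsilon> a b \<mu> y $ 5 = \<mu> * (y - 1)"
  "right_vec \<epsilon> a b \<mu> y $ 6 = \<epsilon> * (a * y - b - \<mu> * (y - 1)) / (2 * \<mu>)"
  "right_vec \<epsilon> a b \<mu> y $ 7 = \<epsilon>"
  unfolding right_vec_def by (simp_all add: vec_of_list_index del: vec_of_list_Cons)

lemma left_vec_index:
  "left_vec \<epsilon> a b \<mu> y $ 0 = a * y"
  "left_vec \<epsilon> a b \<mu> y $ 1 = 0"
  "left_vec \<epsilon> a b \<mu> y $ 2 = \<mu> * (y - 1)"
  "left_vec \<epsilon> a b \<mu> y $ 3 = b"
  "left_vec \<epsilon> a b \<mu> y $ 4 = \<epsilon> * a * y"
  "left_vec \<epsilon> a b \<mu> y $ 5 = \<epsilon> * \<mu> * (y - 1)"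
  "left_vec \<epsilon> a b \<mu> y $ 6 = 0"
  "left_vec \<epsilon> a b \<mu> y $ 7 = \<epsilon> * b"
  unfolding left_vec_def by (simp_all add: vec_of_list_index del: vec_of_list_Cons)

lemma scalar_prod_8:
  assumes "w \<in> carrier_vec 8"
  shows "(v :: complex vec) \<bullet> w = v $ 0 * w $ 0 + v $ 1 * w $ 1 + v $ 2 * w $ 2 + v $ 3 * w $ 3 +
    v $ 4 * w $ 4 + v $ 5 * w $ 5 + v $ 6 * w $ 6 + v $ 7 * w $ 7"
  using assms by (simp add: scalar_prod_def sum_less_8)

text \<open>The zeros of \<open>left_vec\<close> at 1 and 6 remove the entries of
  \<open>right_vec\<close> with denominators, and the remaining entries contribute in equal pairs by
  parity.\<close>

lemma left_right_scalar_prod: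
  assumes "\<epsilon> * \<epsilon> = 1"
  shows "left_vec \<epsilon> a b \<mu> y \<bullet> right_vec \<epsilon> a b \<mu> y =
    2 * (a * y\<^sup>2 + \<epsilon> * \<mu>\<^sup>2 * (y - 1)\<^sup>2 + b)"
proof -
  have ee: "\<epsilon> * (\<epsilon> * c) = c" for c using assms by (simp flip: mult.assoc)
  show ?thesis
    unfolding scalar_prod_8[OF right_left_vec_carrier(1)] right_vec_index left_vec_index
    by (simp add: ee power2_eq_square algebra_simps)
qed

text \<open>For an eigenvector of parity \<epsilon> the equations fix the ratio \<open>y\<close> of
  entries 0 and 3 and then every other entry, so the eigenspace is a line. The opposite parity
  cannot interfere, since the two cubics have no common root when
  \<open>a \<noteq> b\<close>.\<close>

lemma window_mat_simple_eigenvalue: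
  assumes \<epsilon>: "\<epsilon> * \<epsilon> = 1" and ab: "a * b = 1" "a \<noteq> b" and \<mu>: "\<mu> \<noteq> 0" "\<mu> \<noteq> a"
    and root: "parity_poly \<epsilon> a b \<mu> = 0" and y: "y = (b - \<mu>) / (\<mu> - a)"
    and n: "left_vec \<epsilon> a b \<mu> y \<bullet> right_vec \<epsilon> a b \<mu> y \<noteq> 0"
  shows "eigenvalue (window_mat a b) \<mu>"
    and "is_eigenprojection (window_mat a b) \<mu>
      (mat 8 8 (\<lambda>(i, j). right_vec \<epsilon> a b \<mu> y $ i * left_vec \<epsilon> a b \<mu> y $ j /
        (left_vec \<epsilon> a b \<mu> y \<bullet> right_vec \<epsilon> a b \<mu> y)))"
proof -
  let ?x = "right_vec \<epsilon> a b \<mu> y" and ?z = "left_vec \<epsilon> a b \<mu> y"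
  have ee: "\<epsilon> * (\<epsilon> * c) = c" for c using \<epsilon> by (simp flip: mult.assoc)
  have double: "u = v" if "2 * u = 2 * v" for u v :: complex using that by simp
  have y1: "(\<mu> - a) * y = b - \<mu>" using y \<mu> by simp
  then have k1: "a * y + b = \<mu> * y + \<mu>" by (simp add: algebra_simps)
  \<comment> \<open>Multiplication by \<open>\<mu> - a\<close> clears the denominator of
    \<open>y\<close> and turns the difference of the two sides of \<open>k2\<close> into a multiple
    of the cubic.\<close>
  have "(\<mu> - a) * (a * y - b + \<mu> * (y - 1) - 2 * \<epsilon> * \<mu>\<^sup>2 * (y - 1)) =
      (a + \<mu> - 2 * \<epsilon> * \<mu>\<^sup>2) * ((\<mu> - a) * y) - (\<mu> - a) * (b + \<mu> - 2 * \<epsilon> * \<mu>\<^sup>2)"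
    by (simp add: algebra_simps)
  also have "\<dots> = 2 * \<epsilon> * parity_poly \<epsilon> a b \<mu>"
    unfolding y1 using ab(1) \<epsilon> unfolding parity_poly_def
    by (simp add: ee algebra_simps power2_eq_square power3_eq_cube)
  finally have k2: "a * y - b + \<mu> * (y - 1) = 2 * \<epsilon> * \<mu>\<^sup>2 * (y - 1)"
    using root \<mu> by simp
  \<comment> \<open>A common root would satisfy \<open>\<mu>\<^sup>2 = 1\<close> and
    \<open>a + b = 2 * \<mu>\<close>, so \<open>(a + b)\<^sup>2 - 4 * (a * b)\<close> would vanish
    and \<open>a\<close> would equal \<open>b\<close>.\<close>
  have other: "parity_poly (- \<epsilon>) a b \<mu> \<noteq> 0"
  proof
    assume neg: "parity_poly (- \<epsilon>) a b \<mu> = 0"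
    have "2 * \<epsilon> * (1 - \<mu>\<^sup>2) = parity_poly \<epsilon> a b \<mu> - parity_poly (- \<epsilon>) a b \<mu>"
      "2 * \<mu>\<^sup>2 * (2 * \<mu> - (a + b)) = parity_poly \<epsilon> a b \<mu> + parity_poly (- \<epsilon>) a b \<mu>"
      unfolding parity_poly_def by (simp_all add: algebra_simps power2_eq_square power3_eq_cube)
    then have "\<mu>\<^sup>2 = 1" and sum: "a + b = 2 * \<mu>" using root neg \<epsilon> \<mu> by auto
    have "(a - b)\<^sup>2 = (a + b)\<^sup>2 - 4 * (a * b)" by (simp add: power2_eq_square algebra_simps)
    also have "\<dots> = 0" unfolding sum ab(1) using \<open>\<mu>\<^sup>2 = 1\<close> by (simp add: power_mult_distrib)
    finally show False using ab(2) by simp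
  qed
  \<comment> \<open>\<open>k1\<close> and \<open>k2\<close> are linear in \<open>a * y\<close> and
    \<open>b\<close>; solving for these two reduces the eigenvector equations to identities in
    \<epsilon>, \<mu> and \<open>y\<close>.\<close>
  have b: "b = \<mu> * y - \<epsilon> * \<mu>\<^sup>2 * (y - 1)"
  proof (rule double)
    have "2 * b = (a * y + b) - (a * y - b + \<mu> * (y - 1)) + \<mu> * (y - 1)" by simp
    then show "2 * b = 2 * (\<mu> * y - \<epsilon> * \<mu>\<^sup>2 * (y - 1))"
      unfolding k1 k2 by (simp add: algebra_simps)
  qed
  have ay: "a * y = \<mu> + \<epsilon> * \<mu>\<^sup>2 * (y - 1)"
    using k1 unfolding b by (simp add: algebra_simps)
  have aey: "a * (\<epsilon> * y) = \<epsilon> * (a * y)" by simp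
  have cancel: "2 * \<mu> * (c / (2 * \<mu>)) = c" for c using \<mu>(1) by simp
  have right: "window_mat a b *\<^sub>v ?x = \<mu> \<cdot>\<^sub>v ?x"
    unfolding window_mat_eigenvector_iff[OF right_left_vec_carrier(1)] right_vec_index cancel
    unfolding aey ay b using \<mu>(1)
    by (intro conjI) (simp_all add: ee power2_eq_square algebra_simps)
  have "?x $ 3 \<noteq> 0\<^sub>v 8 $ 3" by (simp add: right_vec_index)
  then have "?x \<noteq> 0\<^sub>v 8" by metis
  then show "eigenvalue (window_mat a b) \<mu>"
    using right window_mat_dims[of a b] right_left_vec_carrier(1)
    unfolding eigenvalue_def eigenvector_def by metis
  show "is_eigenprojection (window_mat a b) \<mu> (mat 8 8 (\<lambda>(i, j). ?x $ i * ?z $ j / (?z \<bullet> ?x)))"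
  proof (rule rank_one_eigenprojection)
    fix u :: "complex vec" assume u: "u \<in> carrier_vec 8"
    \<comment> \<open>Twice the image of \<open>u\<close>, free of the factor 1/2. Its product with
      \<open>?z\<close> is grouped by entries of \<open>u\<close>, so that each bracket reduces by
      \<open>k1\<close> or \<open>k2\<close>.\<close>
    define w where "w = vec_of_list
      [a * u $ 0 + b * u $ 3 + u $ 5, a * u $ 0 - b * u $ 3 - u $ 5,
       a * u $ 0 - b * u $ 3 + u $ 5, a * u $ 0 + b * u $ 3 - u $ 5,
       a * u $ 4 + b * u $ 7 + u $ 2, a * u $ 4 - b * u $ 7 + u $ 2,
       a * u $ 4 - b * u $ 7 - u $ 2, a * u $ 4 + b * u $ 7 - u $ 2]"
    have w: "w \<in> carrier_vec 8" by (rule carrier_vecI, simp add: w_def del: vec_of_list_Cons)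
    have "?z \<bullet> w =
        a * u $ 0 * (a * y + b + \<mu> * (y - 1)) + b * u $ 3 * (a * y + b - \<mu> * (y - 1)) +
        u $ 5 * (a * y - b + \<mu> * (y - 1)) + \<epsilon> * (a * u $ 4 * (a * y + b + \<mu> * (y - 1)) +
        b * u $ 7 * (a * y + b - \<mu> * (y - 1)) + u $ 2 * (a * y - b + \<mu> * (y - 1)))"
      unfolding scalar_prod_8[OF w] left_vec_index unfolding w_def
      by (simp add: vec_of_list_index algebra_simps del: vec_of_list_Cons)
    also have "\<dots> = 2 * (\<mu> * (?z \<bullet> u))"
      unfolding k1 k2 scalar_prod_8[OF u] left_vec_index
      by (simp add: ee algebra_simps power2_eq_square)
    finally have "?z \<bullet> w = 2 * (\<mu> * (?z \<bullet> u))" .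
    then show "?z \<bullet> (window_mat a b *\<^sub>v u) = \<mu> * (?z \<bullet> u)"
      unfolding window_mat_mult[OF u] w_def[symmetric]
      using w by (simp add: scalar_prod_smult_distrib[where n = 8])
    assume eig: "window_mat a b *\<^sub>v u = \<mu> \<cdot>\<^sub>v u"
    have eqs: "a * u $ 0 + b * u $ 3 + u $ 5 = 2 * \<mu> * u $ 0"
      "a * u $ 0 - b * u $ 3 - u $ 5 = 2 * \<mu> * u $ 1"
      "a * u $ 0 + b * u $ 3 - u $ 5 = 2 * \<mu> * u $ 3"
      "a * u $ 4 - b * u $ 7 - u $ 2 = 2 * \<mu> * u $ 6"
      using eig unfolding window_mat_eigenvector_iff[OF u] by blast+
    \<comment> \<open>By \<open>other\<close> the part of \<open>u\<close> of parity
      \<open>- \<epsilon>\<close> vanishes; the remaining equations then express every entry as a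
      multiple of \<open>u $ 3\<close>.\<close>
    have "u $ 0 = \<epsilon> * u $ 4" "u $ 2 = \<epsilon> * u $ 5" "u $ 3 = \<epsilon> * u $ 7"
      using parity_component_zero[OF u eig _ ab(1) other] \<epsilon> by simp_all
    then have sym: "u $ 4 = \<epsilon> * u $ 0" "u $ 5 = \<epsilon> * u $ 2" "u $ 7 = \<epsilon> * u $ 3"
      by (simp_all add: ee)
    have "2 * (a * u $ 0 + b * u $ 3) =
        (a * u $ 0 + b * u $ 3 + u $ 5) + (a * u $ 0 + b * u $ 3 - u $ 5)" by simp
    also have "\<dots> = 2 * (\<mu> * (u $ 0 + u $ 3))" unfolding eqs by (simp add: algebra_simps)
    finally have "a * u $ 0 + b * u $ 3 = \<mu> * (u $ 0 + u $ 3)" by (rule double)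
    then have "(\<mu> - a) * u $ 0 = u $ 3 * ((\<mu> - a) * y)" unfolding y1 by (simp add: algebra_simps)
    then have u0: "u $ 0 = u $ 3 * y" using \<mu>(2) by simp
    have "2 * u $ 5 = (a * u $ 0 + b * u $ 3 + u $ 5) - (a * u $ 0 + b * u $ 3 - u $ 5)" by simp
    also have "\<dots> = 2 * (u $ 3 * (\<mu> * (y - 1)))" unfolding eqs unfolding u0 by (simp add: algebra_simps)
    finally have u5: "u $ 5 = u $ 3 * (\<mu> * (y - 1))" by (rule double)
    have "u $ 2 = \<epsilon> * u $ 5" using sym by (simp add: ee)
    then have u2: "u $ 2 = u $ 3 * (\<epsilon> * \<mu> * (y - 1))" unfolding u5 by simp
    have "u $ 1 = (a * u $ 0 - b * u $ 3 - u $ 5) / (2 * \<mu>)" unfolding eqs using \<mu>(1) by simp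
    then have u1: "u $ 1 = u $ 3 * ((a * y - b - \<mu> * (y - 1)) / (2 * \<mu>))"
      unfolding u0 u5 by (simp add: algebra_simps)
    have "u $ 6 = (a * u $ 4 - b * u $ 7 - u $ 2) / (2 * \<mu>)" unfolding eqs using \<mu>(1) by simp
    then have u6: "u $ 6 = u $ 3 * (\<epsilon> * (a * y - b - \<mu> * (y - 1)) / (2 * \<mu>))"
      unfolding sym u2 u0 by (simp add: algebra_simps)
    have u4: "u $ 4 = u $ 3 * (\<epsilon> * y)" unfolding sym u0 by simp
    have u7: "u $ 7 = u $ 3 * \<epsilon>" unfolding sym by simp
    have u3: "u $ 3 = u $ 3 * 1" by simp
    have comps: "\<forall>i<8. u $ i = u $ 3 * ?x $ i"
      unfolding forall_less_8 right_vec_index by (intro conjI u0 u1 u2 u3 u4 u5 u6 u7)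
    have "u = u $ 3 \<cdot>\<^sub>v ?x"
    proof (rule eq_vecI)
      show "u $ i = (u $ 3 \<cdot>\<^sub>v ?x) $ i" if "i < dim_vec (u $ 3 \<cdot>\<^sub>v ?x)" for i
        using comps[rule_format, of i] that by simp
    qed (use u in simp)
    then show "\<exists>\<alpha>. u = \<alpha> \<cdot>\<^sub>v ?x" by blast
  qed (use n in simp_all)
qed

section \<open>Roots of the two cubics\<close>

lemma one_minus_cos_over_square: "((\<lambda>\<delta>::real. (1 - cos \<delta>) / \<delta>\<^sup>2) \<longlongrightarrow> 1 / 2) (at 0)"
  by real_asymp

text \<open>The cubic takes the values -1 at 0 and \<open>2 - 2 * cos \<delta>\<close> at 1, so
  there is a root in between. Subtracting the cubic at \<delta> = 0 writes
  \<open>l \<delta> - 1\<close> as \<open>cos \<delta> - 1\<close> times a factor in [0, 1]. This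
  bound gives convergence of the chosen root, about which no continuity is known beforehand; then
  the factor tends to 1/2, which yields -1/4.\<close>

lemma odd_real_root:
  obtains l :: "real \<Rightarrow> real" where
    "\<And>\<delta>. 2 * l \<delta> ^ 3 - (2 * cos \<delta> - 1) * (l \<delta>)\<^sup>2 - 1 = 0"
    "((\<lambda>\<delta>. (l \<delta> - 1) / \<delta>\<^sup>2) \<longlongrightarrow> - 1 / 4) (at 0)" "(l \<longlongrightarrow> 1) (at 0)"
proof -
  have "\<exists>x. 0 \<le> x \<and> x \<le> 1 \<and> 2 * x ^ 3 - (2 * cos \<delta> - 1) * x\<^sup>2 - 1 = 0" for \<delta> :: real
    by (rule IVT) (auto intro!: continuous_intros)
  then obtain l where l: "\<And>\<delta>::real. 0 \<le> l \<delta>" "\<And>\<delta>. l \<delta> \<le> 1"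
    and root: "\<And>\<delta>. 2 * l \<delta> ^ 3 - (2 * cos \<delta> - 1) * (l \<delta>)\<^sup>2 - 1 = 0"
    by metis
  have den: "2 * (l \<delta>)\<^sup>2 + l \<delta> + 1 > 0" for \<delta>
    using l(1)[of \<delta>] by (simp add: add_nonneg_pos)
  have eq: "l \<delta> - 1 = - (1 - cos \<delta>) * (2 * (l \<delta>)\<^sup>2 / (2 * (l \<delta>)\<^sup>2 + l \<delta> + 1))" for \<delta>
  proof -
    have "(l \<delta> - 1) * (2 * (l \<delta>)\<^sup>2 + l \<delta> + 1) = - (1 - cos \<delta>) * (2 * (l \<delta>)\<^sup>2)"
      using root[of \<delta>]
        by (simp add: power2_eq_square power3_eq_cube algebra_simps)
    then show ?thesis using den[of \<delta>] by (simp add: field_simps)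
  qed
  have lim: "(l \<longlongrightarrow> 1) (at 0)"
  proof -
    have "norm (l \<delta> - 1) \<le> 1 - cos \<delta>" for \<delta>
    proof -
      have "2 * (l \<delta>)\<^sup>2 / (2 * (l \<delta>)\<^sup>2 + l \<delta> + 1) \<in> {0..1}"
        using l(1)[of \<delta>] den[of \<delta>] by (auto simp: divide_le_eq_1)
      then show ?thesis unfolding eq[of \<delta>]
        by (simp add: abs_mult mult_left_le del: times_divide_eq_right times_divide_eq_left abs_divide)
    qed
    moreover have "((\<lambda>\<delta>::real. 1 - cos \<delta>) \<longlongrightarrow> 0) (at 0)" by real_asymp
    ultimately have "((\<lambda>\<delta>. l \<delta> - 1) \<longlongrightarrow> 0) (at 0)"
      by (elim tendsto_0_le[where K = 1]) simp
    then show ?thesis by (simp add: LIM_zero_iff)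
  qed
  have "((\<lambda>\<delta>. - ((1 - cos \<delta>) / \<delta>\<^sup>2) * (2 * (l \<delta>)\<^sup>2 / (2 * (l \<delta>)\<^sup>2 + l \<delta> + 1))) \<longlongrightarrow>
      - (1 / 2) * (2 * 1\<^sup>2 / (2 * 1\<^sup>2 + 1 + 1))) (at 0)"
    by (intro tendsto_intros one_minus_cos_over_square lim) auto
  moreover have "- ((1 - cos \<delta>) / \<delta>\<^sup>2) * (2 * (l \<delta>)\<^sup>2 / (2 * (l \<delta>)\<^sup>2 + l \<delta> + 1)) = (l \<delta> - 1) / \<delta>\<^sup>2" for \<delta>
    unfolding eq[of \<delta>] by (simp add: algebra_simps minus_divide_left)
  ultimately have "((\<lambda>\<delta>. (l \<delta> - 1) / \<delta>\<^sup>2) \<longlongrightarrow> - 1 / 4) (at 0)" by simp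
  then show thesis using that root lim by blast
qed

text \<open>The two-stage argument of the odd case, now on [-1, -1/2] with twice
  \<open>(x + 1 / 2) * (x - 1)\<^sup>2\<close> as the cubic at \<delta> = 0. The factor tends to
  1/9, and -1/2 times 1/9 is -1/18.\<close>

lemma even_real_root:
  obtains r :: "real \<Rightarrow> real" where
    "\<And>\<delta>. 2 * r \<delta> ^ 3 - (2 * cos \<delta> + 1) * (r \<delta>)\<^sup>2 + 1 = 0"
    "((\<lambda>\<delta>. (r \<delta> + 1 / 2) / \<delta>\<^sup>2) \<longlongrightarrow> - 1 / 18) (at 0)" "(r \<longlongrightarrow> - 1 / 2) (at 0)"
    "\<And>\<delta>. r \<delta> < 0"
proof -
  have "\<exists>x. - 1 \<le> x \<and> x \<le> - 1 / 2 \<and> 2 * x ^ 3 - (2 * cos \<delta> + 1) * x\<^sup>2 + 1 = 0" for \<delta> :: real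
    by (rule IVT) (auto intro!: continuous_intros simp: power2_eq_square power3_eq_cube)
  then obtain r where r: "\<And>\<delta>::real. - 1 \<le> r \<delta>" "\<And>\<delta>. r \<delta> \<le> - 1 / 2"
    and root: "\<And>\<delta>. 2 * r \<delta> ^ 3 - (2 * cos \<delta> + 1) * (r \<delta>)\<^sup>2 + 1 = 0"
    by metis
  have den: "(r \<delta> - 1)\<^sup>2 > 0" "(r \<delta>)\<^sup>2 \<le> (r \<delta> - 1)\<^sup>2" for \<delta>
    using r(2)[of \<delta>] abs_le_square_iff[of "r \<delta>" "r \<delta> - 1"] by auto
  have eq: "r \<delta> + 1 / 2 = - (1 - cos \<delta>) * ((r \<delta>)\<^sup>2 / (r \<delta> - 1)\<^sup>2)" for \<delta>
  proof -
    have "(r \<delta> + 1 / 2) * (r \<delta> - 1)\<^sup>2 = - (1 - cos \<delta>) * (r \<delta>)\<^sup>2"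
      using root[of \<delta>] by (simp add: power2_eq_square power3_eq_cube algebra_simps)
    then show ?thesis using den(1)[of \<delta>] by (simp add: eq_divide_eq)
  qed
  have lim: "(r \<longlongrightarrow> - 1 / 2) (at 0)"
  proof -
    have "norm (r \<delta> + 1 / 2) \<le> 1 - cos \<delta>" for \<delta>
    proof -
      have "(r \<delta>)\<^sup>2 / (r \<delta> - 1)\<^sup>2 \<in> {0..1}"
        using den[of \<delta>] by (simp add: divide_le_eq_1)
      then show ?thesis unfolding eq[of \<delta>]
        by (simp add: abs_mult mult_left_le del: times_divide_eq_right times_divide_eq_left abs_divide)
    qed
    moreover have "((\<lambda>\<delta>::real. 1 - cos \<delta>) \<longlongrightarrow> 0) (at 0)" by real_asymp
    ultimately have "((\<lambda>\<delta>. r \<delta> + 1 / 2) \<longlongrightarrow> 0) (at 0)"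
      by (elim tendsto_0_le[where K = 1]) simp
    from tendsto_diff[OF this tendsto_const[of "1 / 2"]] show ?thesis by simp
  qed
  have "((\<lambda>\<delta>. - ((1 - cos \<delta>) / \<delta>\<^sup>2) * ((r \<delta>)\<^sup>2 / (r \<delta> - 1)\<^sup>2)) \<longlongrightarrow>
      - (1 / 2) * ((- 1 / 2)\<^sup>2 / (- 1 / 2 - 1)\<^sup>2)) (at 0)"
    by (intro tendsto_intros one_minus_cos_over_square lim) auto
  moreover have "- ((1 - cos \<delta>) / \<delta>\<^sup>2) * ((r \<delta>)\<^sup>2 / (r \<delta> - 1)\<^sup>2) = (r \<delta> + 1 / 2) / \<delta>\<^sup>2" for \<delta>
    unfolding eq[of \<delta>] by (simp add: algebra_simps minus_divide_left)
  ultimately have "((\<lambda>\<delta>. (r \<delta> + 1 / 2) / \<delta>\<^sup>2) \<longlongrightarrow> - 1 / 18) (at 0)"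
    by (simp add: power2_eq_square)
  moreover have "r \<delta> < 0" for \<delta> using r(2)[of \<delta>] by linarith
  ultimately show thesis using that root lim by blast
qed

lemma even_roots:
  obtains r p w :: "real \<Rightarrow> real" where
    "\<And>\<delta> \<mu>. 2 * \<mu> ^ 3 - complex_of_real (2 * cos \<delta> + 1) * \<mu>\<^sup>2 + 1 =
       2 * (\<mu> - of_real (r \<delta>)) * (\<mu> - Complex (p \<delta>) (w \<delta>)) * (\<mu> - Complex (p \<delta>) (- w \<delta>))"
    "(r \<longlongrightarrow> - 1 / 2) (at 0)"
    "((\<lambda>\<delta>. (p \<delta> - 1) / \<delta>\<^sup>2) \<longlongrightarrow> - 2 / 9) (at 0)"
    "((\<lambda>\<delta>. (w \<delta> - \<delta> / sqrt 3) / \<delta>\<^sup>2) \<longlongrightarrow> 0) (at 0)"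
proof -
  obtain r :: "real \<Rightarrow> real" where
    root: "\<And>\<delta>. 2 * r \<delta> ^ 3 - (2 * cos \<delta> + 1) * (r \<delta>)\<^sup>2 + 1 = 0" and
    r2: "((\<lambda>\<delta>. (r \<delta> + 1 / 2) / \<delta>\<^sup>2) \<longlongrightarrow> - 1 / 18) (at 0)" and
    lim: "(r \<longlongrightarrow> - 1 / 2) (at 0)" and neg: "\<And>\<delta>. r \<delta> < 0"
    using even_real_root by blast
  \<comment> \<open>Eliminating \<open>cos \<delta>\<close> from Vieta's formulas makes the imaginary part of the pair the product of
    \<open>2 sin (\<delta> / 2)\<close> and a function \<open>G\<close> of \<open>r\<close> smooth near \<open>-1/2\<close>; this choice of root keeps the
    sign consistent across \<open>\<delta> = 0\<close>.\<close>
  define G where "G x = sqrt (4 * x\<^sup>2 - 2 * x + 1) / (4 * (- x) * (1 - x))" for x :: real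
  define p where "p \<delta> = 1 / (4 * (r \<delta>)\<^sup>2)" for \<delta>
  define w where "w \<delta> = 2 * sin (\<delta> / 2) * G (r \<delta>)" for \<delta>
  \<comment> \<open>Vieta's formulas give half the sum of the pair as \<open>p \<delta>\<close> and
    their product as \<open>- 1 / (2 * r \<delta>)\<close>. The right side has the factor 8r^3 + 1 =
    (2r + 1)(4r^2 - 2r + 1), in which the cubic trades 2r + 1 for
    \<open>1 - cos \<delta>\<close>.\<close>
  have pw: "(w \<delta>)\<^sup>2 = - 1 / (2 * r \<delta>) - (p \<delta>)\<^sup>2" for \<delta>
  proof -
    have s: "(2 * sin (\<delta> / 2))\<^sup>2 = 2 * (1 - cos \<delta>)"
      using cos_double_sin[of "\<delta> / 2"] by (simp add: power_mult_distrib)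
    have "4 * (r \<delta>)\<^sup>2 - 2 * r \<delta> + 1 \<ge> 0" using neg[of \<delta>] zero_le_power2[of "r \<delta>"] by linarith
    then have g: "(G (r \<delta>))\<^sup>2 = (4 * (r \<delta>)\<^sup>2 - 2 * r \<delta> + 1) / (4 * (- r \<delta>) * (1 - r \<delta>))\<^sup>2"
      by (simp add: G_def power_divide)
    have c: "1 - cos \<delta> = - (r \<delta> + 1 / 2) * (1 - r \<delta>)\<^sup>2 / (r \<delta>)\<^sup>2"
      using root[of \<delta>] neg[of \<delta>] by (simp add: field_simps power2_eq_square power3_eq_cube)
    have "r \<delta> \<noteq> 0" "1 - r \<delta> \<noteq> 0" using neg[of \<delta>] by auto
    then show ?thesis unfolding w_def p_def power_mult_distrib[of _ "G (r \<delta>)"] s g c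
      by (simp add: divide_simps) (simp add: power_numeral_reduce algebra_simps)
  qed
  have c: "2 * cos \<delta> + 1 = (2 * r \<delta> ^ 3 + 1) / (r \<delta>)\<^sup>2" for \<delta>
    using root[of \<delta>] neg[of \<delta>] by (simp add: field_simps)
  have fact: "2 * \<mu> ^ 3 - complex_of_real (2 * cos \<delta> + 1) * \<mu>\<^sup>2 + 1 =
       2 * (\<mu> - of_real (r \<delta>)) * (\<mu> - Complex (p \<delta>) (w \<delta>)) * (\<mu> - Complex (p \<delta>) (- w \<delta>))" for \<mu> \<delta>
  proof -
    define R where "R = complex_of_real (r \<delta>)"
    have R: "R \<noteq> 0" using neg[of \<delta>] by (auto simp: R_def)
    have p: "complex_of_real (p \<delta>) = 1 / (4 * R\<^sup>2)" by (simp add: p_def R_def)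
    have "(\<mu> - Complex (p \<delta>) (w \<delta>)) * (\<mu> - Complex (p \<delta>) (- w \<delta>)) =
        (\<mu> - of_real (p \<delta>))\<^sup>2 + complex_of_real ((w \<delta>)\<^sup>2)"
      unfolding of_real_power by (simp add: complex_eq_iff power2_eq_square algebra_simps)
    also have "\<dots> = \<mu>\<^sup>2 - \<mu> / (2 * R\<^sup>2) - 1 / (2 * R)"
      unfolding pw using p R by (simp add: R_def[symmetric] power2_eq_square field_simps)
    finally have *: "(\<mu> - Complex (p \<delta>) (w \<delta>)) * (\<mu> - Complex (p \<delta>) (- w \<delta>)) =
      \<mu>\<^sup>2 - \<mu> / (2 * R\<^sup>2) - 1 / (2 * R)" .
    have **: "complex_of_real (2 * cos \<delta> + 1) = (2 * R ^ 3 + 1) / R\<^sup>2"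
      unfolding c by (simp add: R_def)
    show ?thesis unfolding mult.assoc * ** R_def[symmetric] using R
      by (simp add: field_simps power2_eq_square power3_eq_cube)
  qed
  \<comment> \<open>From \<open>p \<delta> - 1\<close> = (1 - 4r^2) / (4r^2) the factor
    \<open>r \<delta> + 1 / 2\<close> is split off; the cofactor tends to 4.\<close>
  have "((\<lambda>\<delta>. (1 - 2 * r \<delta>) / (2 * (r \<delta>)\<^sup>2) * ((r \<delta> + 1 / 2) / \<delta>\<^sup>2)) \<longlongrightarrow>
     (1 - 2 * (- 1 / 2)) / (2 * (- 1 / 2)\<^sup>2) * (- 1 / 18)) (at 0)"
    by (intro tendsto_intros lim r2) auto
  moreover have "(1 - 2 * r \<delta>) / (2 * (r \<delta>)\<^sup>2) * ((r \<delta> + 1 / 2) / \<delta>\<^sup>2) = (p \<delta> - 1) / \<delta>\<^sup>2" for \<delta>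
    using neg[of \<delta>] by (simp add: p_def divide_simps) (simp add: algebra_simps power2_eq_square)
  ultimately have p2: "((\<lambda>\<delta>. (p \<delta> - 1) / \<delta>\<^sup>2) \<longlongrightarrow> - 2 / 9) (at 0)"
    by (simp add: power2_eq_square)
  have G0: "G (- 1 / 2) = 1 / sqrt 3"
    by (simp add: G_def power2_eq_square real_div_sqrt field_simps)
  obtain D where D: "(G has_real_derivative D) (at (- 1 / 2))"
  proof -
    have "\<exists>D. (G has_real_derivative D) (at (- 1 / 2))"
      unfolding G_def by (rule exI) (rule derivative_eq_intros refl | simp add: power2_eq_square)+
    then show thesis using that by blast
  qed
  have Gr: "((\<lambda>\<delta>. (G (r \<delta>) - G (- 1 / 2)) / \<delta>) \<longlongrightarrow> 0) (at 0)"
  proof -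
    \<comment> \<open>Caratheodory's form of the derivative allows substituting
      \<open>r \<delta>\<close> without excluding the value -1/2. As
      \<open>r \<delta> + 1 / 2\<close> is of order \<delta>^2, the change of \<open>G\<close> is
      negligible against \<delta>.\<close>
    obtain g where g: "\<And>z. G z - G (- 1 / 2) = g z * (z - (- 1 / 2))" "isCont g (- 1 / 2)"
      using D unfolding CARAT_DERIV by blast
    have "((\<lambda>\<delta>. g (r \<delta>) * ((r \<delta> + 1 / 2) / \<delta>\<^sup>2) * \<delta>) \<longlongrightarrow> g (- 1 / 2) * (- 1 / 18) * 0) (at 0)"
      by (intro tendsto_intros r2 isCont_tendsto_compose[OF g(2)] lim)
    moreover have "g (r \<delta>) * ((r \<delta> + 1 / 2) / \<delta>\<^sup>2) * \<delta> = (G (r \<delta>) - G (- 1 / 2)) / \<delta>" for \<delta>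
      unfolding g(1) by (simp add: power2_eq_square)
    ultimately show ?thesis by simp
  qed
  have "((\<lambda>\<delta>::real. (2 * sin (\<delta> / 2) - \<delta>) / \<delta>\<^sup>2) \<longlongrightarrow> 0) (at 0)" by real_asymp
  moreover have "((\<lambda>\<delta>. G (r \<delta>)) \<longlongrightarrow> G (- 1 / 2)) (at 0)"
    using isCont_tendsto_compose[OF DERIV_isCont[OF D] lim] by simp
  \<comment> \<open>The error of \<open>w \<delta>\<close> against
    \<open>\<delta> * G (- 1 / 2)\<close> is split into the error of the sine and that of
    \<open>G\<close>.\<close>
  ultimately have "((\<lambda>\<delta>. (2 * sin (\<delta> / 2) - \<delta>) / \<delta>\<^sup>2 * G (r \<delta>) + (G (r \<delta>) - G (- 1 / 2)) / \<delta>)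
      \<longlongrightarrow> 0 * G (- 1 / 2) + 0) (at 0)"
    by (intro tendsto_intros Gr)
  moreover have "(2 * sin (\<delta> / 2) - \<delta>) / \<delta>\<^sup>2 * G (r \<delta>) + (G (r \<delta>) - G (- 1 / 2)) / \<delta> =
      (w \<delta> - \<delta> / sqrt 3) / \<delta>\<^sup>2" for \<delta>
    unfolding G0 w_def
    by (cases "\<delta> = 0") (simp_all add: diff_divide_distrib add_divide_distrib power2_eq_square algebra_simps)
  ultimately have "((\<lambda>\<delta>. (w \<delta> - \<delta> / sqrt 3) / \<delta>\<^sup>2) \<longlongrightarrow> 0) (at 0)" by simp
  then show thesis using that fact lim p2 by blast
qed

section \<open>Perturbation of the eigenvalue 1\<close>

lemma exp_quotient_tendsto:
  "((\<lambda>\<delta>::real. (exp (c * of_real \<delta>) - 1) / of_real \<delta>) \<longlongrightarrow> c) (at 0)" for c :: complex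
proof -
  have "((\<lambda>z. exp (c * z)) has_field_derivative c) (at 0)"
    by (auto intro!: derivative_eq_intros)
  then have "((\<lambda>h. (exp (c * h) - 1) / h) \<longlongrightarrow> c) (at 0)"
    by (simp add: DERIV_def)
  moreover have "((\<lambda>\<delta>::real. complex_of_real \<delta>) \<longlongrightarrow> of_real 0) (at 0)"
    by (intro tendsto_intros)
  then have "filterlim complex_of_real (at 0) (at 0)"
    by (simp add: filterlim_at eventually_at_filter)
  ultimately show ?thesis by (rule filterlim_compose)
qed

lemma tendsto_one_of_quotient:
  assumes "((\<lambda>\<delta>::real. (f \<delta> - 1) / complex_of_real \<delta>) \<longlongrightarrow> c) (at 0)"
  shows "(f \<longlongrightarrow> 1) (at 0)"
proof -
  have "((\<lambda>\<delta>. (f \<delta> - 1) / of_real \<delta> * of_real \<delta> + 1) \<longlongrightarrow> c * of_real 0 + 1) (at 0)"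
    by (intro tendsto_intros assms)
  moreover have "\<forall>\<^sub>F \<delta> in at 0. (f \<delta> - 1) / of_real \<delta> * of_real \<delta> + 1 = f \<delta>"
    by (simp add: eventually_at_filter)
  ultimately show ?thesis using tendsto_cong by force
qed

lemma tendsto_right_vec:
  assumes "(a \<longlongrightarrow> a0) F" "(b \<longlongrightarrow> b0) F" "(\<mu> \<longlongrightarrow> \<mu>0) F" "(y \<longlongrightarrow> y0) F" "\<mu>0 \<noteq> 0" "i < 8"
  shows "((\<lambda>\<delta>. right_vec \<epsilon> (a \<delta>) (b \<delta>) (\<mu> \<delta>) (y \<delta>) $ i) \<longlongrightarrow> right_vec \<epsilon> a0 b0 \<mu>0 y0 $ i) F"
proof -
  have "\<forall>i<8. ((\<lambda>\<delta>. right_vec \<epsilon> (a \<delta>) (b \<delta>) (\<mu> \<delta>) (y \<delta>) $ i) \<longlongrightarrow>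
      right_vec \<epsilon> a0 b0 \<mu>0 y0 $ i) F"
    unfolding forall_less_8 right_vec_index
    using assms(5) by (intro conjI tendsto_intros assms(1-4)) auto
  then show ?thesis using assms(6) by blast
qed

lemma tendsto_left_vec:
  assumes "(a \<longlongrightarrow> a0) F" "(b \<longlongrightarrow> b0) F" "(\<mu> \<longlongrightarrow> \<mu>0) F" "(y \<longlongrightarrow> y0) F" "i < 8"
  shows "((\<lambda>\<delta>. left_vec \<epsilon> (a \<delta>) (b \<delta>) (\<mu> \<delta>) (y \<delta>) $ i) \<longlongrightarrow> left_vec \<epsilon> a0 b0 \<mu>0 y0 $ i) F"
proof -
  have "\<forall>i<8. ((\<lambda>\<delta>. left_vec \<epsilon> (a \<delta>) (b \<delta>) (\<mu> \<delta>) (y \<delta>) $ i) \<longlongrightarrow>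
      left_vec \<epsilon> a0 b0 \<mu>0 y0 $ i) F"
    unfolding forall_less_8 left_vec_index
    by (intro conjI tendsto_intros assms(1-4))
  then show ?thesis using assms(5) by blast
qed

text \<open>Translation invariance makes the matrix the same for both windows, so \<open>s\<close>
  and \<open>t\<close> do not appear.\<close>

definition perturbed_window :: "real \<Rightarrow> complex mat" where
  "perturbed_window \<delta> = window_mat (exp (- \<i> * of_real \<delta>)) (exp (\<i> * of_real \<delta>))"

definition perturbed_poly :: "complex \<Rightarrow> real \<Rightarrow> complex \<Rightarrow> complex" where
  "perturbed_poly \<epsilon> \<delta> = parity_poly \<epsilon> (exp (- \<i> * of_real \<delta>)) (exp (\<i> * of_real \<delta>))"

lemma perturbed_poly_eq:
  "perturbed_poly \<epsilon> \<delta> \<mu> = 2 * \<mu> ^ 3 - (of_real (2 * cos \<delta>) + \<epsilon>) * \<mu>\<^sup>2 + \<epsilon>"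
proof -
  have "exp (- \<i> * of_real \<delta>) + exp (\<i> * of_real \<delta>) = of_real (2 * cos \<delta>)"
    using cis_conv_exp[of \<delta>] cis_conv_exp[of "- \<delta>"] by (simp add: complex_eq_iff)
  then show ?thesis unfolding perturbed_poly_def parity_poly_def by simp
qed

text \<open>The ratio (b - \<mu>) / (\<mu> - a) has the form 0/0 at \<delta> = 0; the slopes
  \<open>- \<i>\<close>, \<open>\<i>\<close> and \<open>\<i> * \<sigma>\<close> of a, b and \<mu>
  give it the limit (1 - \<sigma>) / (1 + \<sigma>). There the left and right eigenvectors become
  equal and real; for odd parity this needs y = 1, which kills the entries 2 and 5 of opposite sign.
  The scaling \<kappa> then makes the limiting projection \<open>outer_prod v v\<close>.\<close>

lemma eigenvalue_branch:
  fixes \<mu> :: "real \<Rightarrow> complex" and y \<kappa> \<sigma> :: real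
  assumes \<epsilon>: "\<epsilon> = 1 \<or> \<epsilon> = - 1 \<and> y = 1"
    and root: "\<forall>\<^sub>F \<delta> in at 0. perturbed_poly \<epsilon> \<delta> (\<mu> \<delta>) = 0"
    and lim: "((\<lambda>\<delta>. (\<mu> \<delta> - 1) / of_real \<delta>) \<longlongrightarrow> \<i> * of_real \<sigma>) (at 0)"
    and \<sigma>: "\<sigma> \<noteq> - 1" "y = (1 - \<sigma>) / (1 + \<sigma>)"
    and \<kappa>: "of_real (\<kappa>\<^sup>2) * (2 * (of_real (y\<^sup>2) + \<epsilon> * of_real ((y - 1)\<^sup>2) + 1)) = 1"
    and v: "v = of_real \<kappa> \<cdot>\<^sub>v right_vec \<epsilon> 1 1 1 (of_real y)"
  shows "eigenvalue_near_circle perturbed_window \<mu>"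
    and "eigenprojections_tendsto perturbed_window \<mu> (outer_prod v v)"
proof -
  define a b where "a \<delta> = exp (- \<i> * of_real \<delta>)" and "b \<delta> = exp (\<i> * of_real \<delta>)" for \<delta> :: real
  have ab: "a \<delta> * b \<delta> = 1" for \<delta> by (simp add: a_def b_def flip: exp_add)
  have ee: "\<epsilon> * \<epsilon> = 1" using \<epsilon> by auto
  define \<tau> where "\<tau> = \<i> * complex_of_real \<sigma>"
  note lim = lim[folded \<tau>_def]
  have \<tau>: "\<tau> + \<i> \<noteq> 0" "(\<i> - \<tau>) / (\<tau> + \<i>) = of_real y"
  proof -
    have eq: "\<tau> + \<i> = \<i> * of_real (1 + \<sigma>)" "\<i> - \<tau> = \<i> * of_real (1 - \<sigma>)"
      by (simp_all add: \<tau>_def algebra_simps)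
    show "\<tau> + \<i> \<noteq> 0" using \<sigma>(1) unfolding eq by (simp del: of_real_add)
    show "(\<i> - \<tau>) / (\<tau> + \<i>) = of_real y" unfolding eq \<sigma>(2) by simp
  qed
  have qa: "((\<lambda>\<delta>. (a \<delta> - 1) / of_real \<delta>) \<longlongrightarrow> - \<i>) (at 0)"
    and qb: "((\<lambda>\<delta>. (b \<delta> - 1) / of_real \<delta>) \<longlongrightarrow> \<i>) (at 0)"
    unfolding a_def b_def by (rule exp_quotient_tendsto)+
  note a1 = tendsto_one_of_quotient[OF qa] and b1 = tendsto_one_of_quotient[OF qb]
    and \<mu>1 = tendsto_one_of_quotient[OF lim]
  \<comment> \<open>All quantities meet at 1 when \<delta> = 0; that they differ for small \<delta>
    \<noteq> 0 follows from the distinct limits of their difference quotients.\<close>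
  have "((\<lambda>\<delta>. (b \<delta> - 1) / of_real \<delta> - (a \<delta> - 1) / of_real \<delta>) \<longlongrightarrow> \<i> - - \<i>) (at 0)"
    by (intro tendsto_diff qa qb)
  then have "\<forall>\<^sub>F \<delta> in at 0. (b \<delta> - 1) / of_real \<delta> - (a \<delta> - 1) / of_real \<delta> \<noteq> 0"
    by (rule tendsto_imp_eventually_ne) simp
  then have ne_ab: "\<forall>\<^sub>F \<delta> in at 0. a \<delta> \<noteq> b \<delta>" by eventually_elim auto
  have q\<mu>a: "((\<lambda>\<delta>. (\<mu> \<delta> - 1) / of_real \<delta> - (a \<delta> - 1) / of_real \<delta>) \<longlongrightarrow> \<tau> - - \<i>) (at 0)"
    by (intro tendsto_diff lim qa)
  then have "\<forall>\<^sub>F \<delta> in at 0. (\<mu> \<delta> - 1) / of_real \<delta> - (a \<delta> - 1) / of_real \<delta> \<noteq> 0"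
    by (rule tendsto_imp_eventually_ne) (use \<tau>(1) in simp)
  then have ne_\<mu>a: "\<forall>\<^sub>F \<delta> in at 0. \<mu> \<delta> \<noteq> a \<delta>" by eventually_elim auto
  have ne_\<mu>: "\<forall>\<^sub>F \<delta> in at 0. \<mu> \<delta> \<noteq> 0" using \<mu>1 by (rule tendsto_imp_eventually_ne) simp
  define Y where "Y \<delta> = (b \<delta> - \<mu> \<delta>) / (\<mu> \<delta> - a \<delta>)" for \<delta>
  \<comment> \<open>Numerator and denominator of \<open>Y\<close> are both divided by \<delta> to
    resolve the indeterminate form.\<close>
  have "((\<lambda>\<delta>. ((b \<delta> - 1) / of_real \<delta> - (\<mu> \<delta> - 1) / of_real \<delta>) /
      ((\<mu> \<delta> - 1) / of_real \<delta> - (a \<delta> - 1) / of_real \<delta>)) \<longlongrightarrow> (\<i> - \<tau>) / (\<tau> - - \<i>)) (at 0)"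
    by (intro tendsto_divide tendsto_diff[OF qb lim] q\<mu>a) (use \<tau>(1) in simp)
  moreover have "\<forall>\<^sub>F \<delta> in at 0. ((b \<delta> - 1) / of_real \<delta> - (\<mu> \<delta> - 1) / of_real \<delta>) /
      ((\<mu> \<delta> - 1) / of_real \<delta> - (a \<delta> - 1) / of_real \<delta>) = Y \<delta>"
    by (simp add: eventually_at_filter Y_def flip: diff_divide_distrib)
  ultimately have Y: "(Y \<longlongrightarrow> of_real y) (at 0)" using tendsto_cong \<tau>(2) by force
  define x z where "x \<delta> = right_vec \<epsilon> (a \<delta>) (b \<delta>) (\<mu> \<delta>) (Y \<delta>)"
    and "z \<delta> = left_vec \<epsilon> (a \<delta>) (b \<delta>) (\<mu> \<delta>) (Y \<delta>)" for \<delta>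
  define x0 z0 where "x0 = right_vec \<epsilon> 1 1 1 (of_real y)" and "z0 = left_vec \<epsilon> 1 1 1 (of_real y)"
  have x: "((\<lambda>\<delta>. x \<delta> $ i) \<longlongrightarrow> x0 $ i) (at 0)" and z: "((\<lambda>\<delta>. z \<delta> $ i) \<longlongrightarrow> z0 $ i) (at 0)"
    if "i < 8" for i
    unfolding x_def z_def x0_def z0_def
    using tendsto_right_vec[OF a1 b1 \<mu>1 Y] tendsto_left_vec[OF a1 b1 \<mu>1 Y] that by auto
  define N where "N = 2 * (of_real (y\<^sup>2) + \<epsilon> * of_real ((y - 1)\<^sup>2) + 1)"
  have N: "((\<lambda>\<delta>. z \<delta> \<bullet> x \<delta>) \<longlongrightarrow> N) (at 0)"
  proof -
    have "((\<lambda>\<delta>. 2 * (a \<delta> * (Y \<delta>)\<^sup>2 + \<epsilon> * (\<mu> \<delta>)\<^sup>2 * (Y \<delta> - 1)\<^sup>2 + b \<delta>)) \<longlongrightarrow>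
        2 * (1 * (of_real y)\<^sup>2 + \<epsilon> * 1\<^sup>2 * (of_real y - 1)\<^sup>2 + 1)) (at 0)"
      by (intro tendsto_intros a1 b1 \<mu>1 Y)
    then show ?thesis unfolding x_def z_def left_right_scalar_prod[OF ee] N_def by simp
  qed
  have N0: "N \<noteq> 0" using \<kappa> unfolding N_def by auto
  then have ne_N: "\<forall>\<^sub>F \<delta> in at 0. z \<delta> \<bullet> x \<delta> \<noteq> 0" using N tendsto_imp_eventually_ne by blast
  define E where "E \<delta> = mat 8 8 (\<lambda>(i, j). x \<delta> $ i * z \<delta> $ j / (z \<delta> \<bullet> x \<delta>))" for \<delta>
  have "\<forall>\<^sub>F \<delta> in at 0. eigenvalue (perturbed_window \<delta>) (\<mu> \<delta>) \<and>
      is_eigenprojection (perturbed_window \<delta>) (\<mu> \<delta>) (E \<delta>)"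
    using root ne_ab ne_\<mu>a ne_\<mu> ne_N
  proof eventually_elim
    case (elim \<delta>)
    have "parity_poly \<epsilon> (a \<delta>) (b \<delta>) (\<mu> \<delta>) = 0"
      using elim(1) by (simp add: perturbed_poly_def a_def b_def)
    from window_mat_simple_eigenvalue[OF ee ab elim(2,4,3) this Y_def elim(5)[unfolded x_def z_def]]
    show ?case unfolding perturbed_window_def E_def x_def z_def a_def b_def by blast
  qed
  then have ev: "\<forall>\<^sub>F \<delta> in at 0. eigenvalue (perturbed_window \<delta>) (\<mu> \<delta>)"
    and proj: "\<forall>\<^sub>F \<delta> in at 0. is_eigenprojection (perturbed_window \<delta>) (\<mu> \<delta>) (E \<delta>)"
    by (auto elim: eventually_mono)
  show "eigenvalue_near_circle perturbed_window \<mu>"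
    unfolding eigenvalue_near_circle_def using ev tendsto_norm[OF \<mu>1] by simp
  have dim: "dim_vec v = 8" by (simp add: v)
  have xz: "x0 $ i = z0 $ i" "cnj (x0 $ i) = x0 $ i" if "i < 8" for i
  proof -
    have "\<forall>i<8. x0 $ i = z0 $ i" "\<forall>i<8. cnj (x0 $ i) = x0 $ i"
      unfolding forall_less_8 x0_def z0_def right_vec_index left_vec_index using \<epsilon> by auto
    then show "x0 $ i = z0 $ i" "cnj (x0 $ i) = x0 $ i" using that by blast+
  qed
  have "((\<lambda>\<delta>. E \<delta> $$ (i, j)) \<longlongrightarrow> outer_prod v v $$ (i, j)) (at 0)" if "i < 8" "j < 8" for i j
  proof -
    have "of_real (\<kappa>\<^sup>2) * N = 1" using \<kappa> by (simp only: N_def)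
    then have "of_real (\<kappa>\<^sup>2) = 1 / N" using N0 by (simp only: eq_divide_eq) simp
    moreover have "outer_prod v v $$ (i, j) = of_real (\<kappa>\<^sup>2) * (x0 $ i * cnj (x0 $ j))"
      using that dim by (simp add: outer_prod_def v x0_def power2_eq_square)
    ultimately have "outer_prod v v $$ (i, j) = x0 $ i * z0 $ j / N"
      using xz that by simp
    moreover have "((\<lambda>\<delta>. x \<delta> $ i * z \<delta> $ j / (z \<delta> \<bullet> x \<delta>)) \<longlongrightarrow> x0 $ i * z0 $ j / N) (at 0)"
      by (intro tendsto_intros x z N N0 that)
    ultimately show ?thesis using that by (simp add: E_def)
  qed
  then show "eigenprojections_tendsto perturbed_window \<mu> (outer_prod v v)"
    unfolding eigenprojections_tendsto_def
    by (intro exI[of _ E] conjI proj) (auto simp: outer_prod_def dim E_def)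
qed

section \<open>Moduli of the remaining roots of the odd cubic\<close>

lemma norm_root_of_real_quadratic:
  fixes z :: complex and u q :: real
  assumes "z\<^sup>2 + of_real u * z + of_real q = 0" and "u\<^sup>2 < 4 * q"
  shows "(cmod z)\<^sup>2 = q"
proof -
  have re: "(Re z)\<^sup>2 - (Im z)\<^sup>2 + u * Re z + q = 0" and im: "Im z * (2 * Re z + u) = 0"
    using assms(1) by (auto simp: complex_eq_iff power2_eq_square algebra_simps)
  \<comment> \<open>For real \<open>z\<close> completing the square contradicts the negative
    discriminant. The roots are thus a conjugate pair, whose product \<open>q\<close> is the squared
    modulus.\<close>
  have "Im z \<noteq> 0"
  proof
    assume "Im z = 0"
    then have "4 * q - u\<^sup>2 = - (2 * Re z + u)\<^sup>2"
      using re by (simp add: power2_eq_square algebra_simps)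
    then show False using assms(2) zero_le_power2[of "2 * Re z + u"] by linarith
  qed
  then have u: "u = - 2 * Re z" using im by simp
  show ?thesis using re unfolding u cmod_power2 by (simp add: power2_eq_square)
qed

text \<open>Eliminating \<open>c\<close> through the root \<open>l\<close> and dividing by
  \<open>z - l\<close> leaves a real quadratic whose conjugate roots have squared modulus 1 / (2l).
  One threshold serves for both \<open>l\<close> and the modulus because 1/2 \<le> (9/10)^3.\<close>

lemma norm_odd_root:
  fixes z :: complex and l c :: real
  assumes "2 * z ^ 3 - (of_real (2 * c) - 1) * z\<^sup>2 - 1 = 0"
    and l: "2 * l ^ 3 - (2 * c - 1) * l\<^sup>2 - 1 = 0" "9 / 10 < l" and "z \<noteq> of_real l"
  shows "cmod z \<le> 9 / 10"
proof -
  have l0: "l \<noteq> 0" using l(2) by simp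
  have c: "2 * c - 1 = (2 * l ^ 3 - 1) / l\<^sup>2" using l(1) l0 by (simp add: field_simps)
  define L where "L = complex_of_real l"
  have L0: "L \<noteq> 0" using l0 by (simp add: L_def)
  have "complex_of_real (2 * c) - 1 = (2 * L ^ 3 - 1) / L\<^sup>2"
    using arg_cong[OF c, of complex_of_real] by (simp add: L_def)
  with assms(1) have "2 * z ^ 3 - (2 * L ^ 3 - 1) / L\<^sup>2 * z\<^sup>2 - 1 = 0" by simp
  moreover have "2 * z ^ 3 - (2 * L ^ 3 - 1) / L\<^sup>2 * z\<^sup>2 - 1 =
      2 * (z - L) * (z\<^sup>2 + 1 / (2 * L\<^sup>2) * z + 1 / (2 * L))"
    using L0 by (simp add: field_simps power2_eq_square power3_eq_cube)
  ultimately have "z\<^sup>2 + 1 / (2 * L\<^sup>2) * z + 1 / (2 * L) = 0"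
    using assms(4) by (simp add: L_def)
  then have *: "z\<^sup>2 + of_real (1 / (2 * l\<^sup>2)) * z + of_real (1 / (2 * l)) = 0"
    by (simp add: L_def)
  have "(9 / 10) ^ 3 < l ^ 3" using l(2) by (intro power_strict_mono) auto
  then have "1 < 8 * l ^ 3" by (simp add: power3_eq_cube)
  then have "(1 / (2 * l\<^sup>2))\<^sup>2 < 4 * (1 / (2 * l))"
    using l(2) by (simp add: divide_simps power2_eq_square power3_eq_cube)
  from norm_root_of_real_quadratic[OF * this] have "(cmod z)\<^sup>2 = 1 / (2 * l)" .
  also have "\<dots> \<le> (9 / 10)\<^sup>2" using l(2) by (simp add: divide_simps power2_eq_square)
  finally show ?thesis by (rule power2_le_imp_le) simp
qed

lemma smallo_square:
  fixes h :: "real \<Rightarrow> complex"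
  assumes "((\<lambda>\<delta>. h \<delta> / of_real (\<delta>\<^sup>2)) \<longlongrightarrow> 0) (at 0)"
  shows "h \<in> o[at 0](\<lambda>\<delta>. of_real (\<delta>\<^sup>2))"
  by (rule smalloI_tendsto[OF assms]) (simp add: eventually_at_filter)

lemma tendsto_quotient_of_square:
  fixes f :: "real \<Rightarrow> real"
  assumes "((\<lambda>\<delta>. f \<delta> / \<delta>\<^sup>2) \<longlongrightarrow> c) (at 0)"
  shows "((\<lambda>\<delta>. f \<delta> / \<delta>) \<longlongrightarrow> 0) (at 0)"
proof -
  have "((\<lambda>\<delta>. f \<delta> / \<delta>\<^sup>2 * \<delta>) \<longlongrightarrow> c * 0) (at 0)" by (intro tendsto_intros assms)
  moreover have "f \<delta> / \<delta>\<^sup>2 * \<delta> = f \<delta> / \<delta>" for \<delta> by (simp add: power2_eq_square)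
  ultimately show ?thesis by simp
qed

lemma W_hat_eq_perturbed_window:
  assumes "(s, t) \<in> {(- 1, 0), (0, 1)}"
  shows "W_hat s t = perturbed_window"
proof -
  have "t = s + 1" using assms by auto
  then show ?thesis by (intro ext) (simp only: W_hat_window_mat perturbed_window_def)
qed

section \<open>The prescribed vectors as limits of right eigenvectors\<close>

lemma smult_right_vec_eq:
  assumes "length xs = 8" "\<And>i. i < 8 \<Longrightarrow> xs ! i = k * right_vec \<epsilon> 1 1 1 y $ i"
  shows "vec_of_list xs = k \<cdot>\<^sub>v right_vec \<epsilon> 1 1 1 y"
  using assms by (intro eq_vecI) (simp_all add: vec_of_list_index)

lemma v1_eq: "v1 = of_real (- 1 / 2) \<cdot>\<^sub>v right_vec (- 1) 1 1 1 (of_real 1)"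
proof -
  have "\<forall>i<8. [-1/2, 0, 0, -1/2, 1/2, 0, 0, 1/2] ! i = of_real (- 1 / 2) * right_vec (- 1) 1 1 1 (of_real 1) $ i"
    unfolding forall_less_8 right_vec_index by simp
  then show ?thesis unfolding v1_def by (intro smult_right_vec_eq) auto
qed

text \<open>With \<open>y = 2 - sqrt 3\<close> and \<open>y = 2 + sqrt 3\<close> these are the
  unnormalized \<open>v2\<close> and \<open>v3\<close>.\<close>

lemma even_vec_eq:
  "vec_of_list (map complex_of_real [y, 0, y - 1, 1, y, y - 1, 0, 1]) = right_vec 1 1 1 1 (of_real y)"
proof -
  have "\<forall>i<8. map complex_of_real [y, 0, y - 1, 1, y, y - 1, 0, 1] ! i = 1 * right_vec 1 1 1 1 (of_real y) $ i"
    unfolding forall_less_8 right_vec_index by simp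
  then have "vec_of_list (map complex_of_real [y, 0, y - 1, 1, y, y - 1, 0, 1]) =
      1 \<cdot>\<^sub>v right_vec 1 1 1 1 (of_real y)"
    by (intro smult_right_vec_eq) auto
  then show ?thesis by simp
qed

text \<open>The slope \<sigma> is a parameter so that both members of the conjugate pair are
  covered, with \<open>w\<close> and its negative. The first limit supplies the slope for
  \<open>eigenvalue_branch\<close>, the second the claimed expansion.\<close>

lemma complex_branch_asymptotics:
  fixes p w :: "real \<Rightarrow> real"
  assumes p: "((\<lambda>\<delta>. (p \<delta> - 1) / \<delta>\<^sup>2) \<longlongrightarrow> - 2 / 9) (at 0)"
    and w: "((\<lambda>\<delta>. (w \<delta> - \<sigma> * \<delta>) / \<delta>\<^sup>2) \<longlongrightarrow> 0) (at 0)"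
  shows "((\<lambda>\<delta>. (Complex (p \<delta>) (w \<delta>) - 1) / of_real \<delta>) \<longlongrightarrow> \<i> * of_real \<sigma>) (at 0)"
    and "(\<lambda>\<delta>. Complex (p \<delta>) (w \<delta>) - (1 + \<i> * of_real (\<sigma> * \<delta>) - of_real (2 / 9 * \<delta>\<^sup>2)))
      \<in> o[at 0](\<lambda>\<delta>. of_real (\<delta>\<^sup>2))"
proof -
  have "((\<lambda>\<delta>. of_real ((p \<delta> - 1) / \<delta>) + \<i> * of_real ((w \<delta> - \<sigma> * \<delta>) / \<delta> + \<sigma>)) \<longlongrightarrow>
      of_real 0 + \<i> * of_real (0 + \<sigma>)) (at 0)"
    by (intro tendsto_intros tendsto_quotient_of_square[OF p] tendsto_quotient_of_square[OF w])
  moreover have "\<forall>\<^sub>F \<delta> in at 0. of_real ((p \<delta> - 1) / \<delta>) + \<i> * of_real ((w \<delta> - \<sigma> * \<delta>) / \<delta> + \<sigma>) =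
      (Complex (p \<delta>) (w \<delta>) - 1) / of_real \<delta>"
    by (auto simp: eventually_at_filter complex_eq_iff field_simps)
  ultimately show "((\<lambda>\<delta>. (Complex (p \<delta>) (w \<delta>) - 1) / of_real \<delta>) \<longlongrightarrow> \<i> * of_real \<sigma>) (at 0)"
    using tendsto_cong by force
  have "((\<lambda>\<delta>. of_real ((p \<delta> - 1) / \<delta>\<^sup>2 + 2 / 9) + \<i> * of_real ((w \<delta> - \<sigma> * \<delta>) / \<delta>\<^sup>2)) \<longlongrightarrow>
      of_real (- 2 / 9 + 2 / 9) + \<i> * of_real 0) (at 0)"
    by (intro tendsto_intros p w)
  moreover have "\<forall>\<^sub>F \<delta> in at 0.
      of_real ((p \<delta> - 1) / \<delta>\<^sup>2 + 2 / 9) + \<i> * of_real ((w \<delta> - \<sigma> * \<delta>) / \<delta>\<^sup>2) =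
      (Complex (p \<delta>) (w \<delta>) - (1 + \<i> * of_real (\<sigma> * \<delta>) - of_real (2 / 9 * \<delta>\<^sup>2))) / of_real (\<delta>\<^sup>2)"
    by (auto simp: eventually_at_filter complex_eq_iff field_simps simp flip: of_real_power)
  ultimately show "(\<lambda>\<delta>. Complex (p \<delta>) (w \<delta>) - (1 + \<i> * of_real (\<sigma> * \<delta>) - of_real (2 / 9 * \<delta>\<^sup>2)))
      \<in> o[at 0](\<lambda>\<delta>. of_real (\<delta>\<^sup>2))"
    by (intro smallo_square) (use tendsto_cong in force)
qed

section \<open>The three branches near 1 and their completeness\<close>

theorem theorem4p1:
  fixes s t :: int
  assumes "(s, t) \<in> {(-1, 0), (0, 1)}"
  shows "\<exists>\<mu>\<^sub>1 \<mu>\<^sub>2 \<mu>\<^sub>3 :: real \<Rightarrow> complex.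
    eigenvalue_near_circle (W_hat s t) \<mu>\<^sub>1 \<and>
    eigenvalue_near_circle (W_hat s t) \<mu>\<^sub>2 \<and>
    eigenvalue_near_circle (W_hat s t) \<mu>\<^sub>3 \<and>
    (\<forall>\<nu>. eigenvalue_near_circle (W_hat s t) \<nu> \<longrightarrow>
       (\<forall>\<^sub>F \<delta> in at 0. \<nu> \<delta> \<in> {\<mu>\<^sub>1 \<delta>, \<mu>\<^sub>2 \<delta>, \<mu>\<^sub>3 \<delta>})) \<and>
    (\<lambda>\<delta>. \<mu>\<^sub>1 \<delta> - (1 - of_real (\<delta>\<^sup>2 / 4))) \<in> o[at 0](\<lambda>\<delta>. of_real (\<delta>\<^sup>2)) \<and>
    (\<lambda>\<delta>. \<mu>\<^sub>2 \<delta> - (1 + \<i> * of_real (\<delta> / sqrt 3) - of_real (2 / 9 * \<delta>\<^sup>2)))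
       \<in> o[at 0](\<lambda>\<delta>. of_real (\<delta>\<^sup>2)) \<and>
    (\<lambda>\<delta>. \<mu>\<^sub>3 \<delta> - (1 - \<i> * of_real (\<delta> / sqrt 3) - of_real (2 / 9 * \<delta>\<^sup>2)))
       \<in> o[at 0](\<lambda>\<delta>. of_real (\<delta>\<^sup>2)) \<and>
    eigenprojections_tendsto (W_hat s t) \<mu>\<^sub>1 (outer_prod v1 v1) \<and>
    eigenprojections_tendsto (W_hat s t) \<mu>\<^sub>2 (outer_prod v2 v2) \<and>
    eigenprojections_tendsto (W_hat s t) \<mu>\<^sub>3 (outer_prod v3 v3)"
proof -
  obtain l :: "real \<Rightarrow> real" where
    l_root: "\<And>\<delta>. 2 * l \<delta> ^ 3 - (2 * cos \<delta> - 1) * (l \<delta>)\<^sup>2 - 1 = 0" and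
    l2: "((\<lambda>\<delta>. (l \<delta> - 1) / \<delta>\<^sup>2) \<longlongrightarrow> - 1 / 4) (at 0)" and l1: "(l \<longlongrightarrow> 1) (at 0)"
    using odd_real_root by blast
  obtain r p w :: "real \<Rightarrow> real" where
    fact: "\<And>\<delta> \<mu>. 2 * \<mu> ^ 3 - complex_of_real (2 * cos \<delta> + 1) * \<mu>\<^sup>2 + 1 =
       2 * (\<mu> - of_real (r \<delta>)) * (\<mu> - Complex (p \<delta>) (w \<delta>)) * (\<mu> - Complex (p \<delta>) (- w \<delta>))" and
    r1: "(r \<longlongrightarrow> - 1 / 2) (at 0)" and
    p2: "((\<lambda>\<delta>. (p \<delta> - 1) / \<delta>\<^sup>2) \<longlongrightarrow> - 2 / 9) (at 0)" and
    w2: "((\<lambda>\<delta>. (w \<delta> - \<delta> / sqrt 3) / \<delta>\<^sup>2) \<longlongrightarrow> 0) (at 0)"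
    using even_roots by blast
  define \<mu>1 \<mu>2 \<mu>3 where "\<mu>1 \<delta> = complex_of_real (l \<delta>)" and "\<mu>2 \<delta> = Complex (p \<delta>) (w \<delta>)"
    and "\<mu>3 \<delta> = Complex (p \<delta>) (- w \<delta>)" for \<delta>
  have even_poly: "perturbed_poly 1 \<delta> \<mu> = 2 * (\<mu> - of_real (r \<delta>)) * (\<mu> - \<mu>2 \<delta>) * (\<mu> - \<mu>3 \<delta>)" for \<delta> \<mu>
    unfolding perturbed_poly_eq \<mu>2_def \<mu>3_def fact[symmetric] by simp
  have w_plus: "((\<lambda>\<delta>. (w \<delta> - 1 / sqrt 3 * \<delta>) / \<delta>\<^sup>2) \<longlongrightarrow> 0) (at 0)" using w2 by simp
  have w_minus: "((\<lambda>\<delta>. (- w \<delta> - - (1 / sqrt 3) * \<delta>) / \<delta>\<^sup>2) \<longlongrightarrow> 0) (at 0)"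
  proof -
    have "(- w \<delta> - - (1 / sqrt 3) * \<delta>) / \<delta>\<^sup>2 = - ((w \<delta> - \<delta> / sqrt 3) / \<delta>\<^sup>2)" for \<delta>
    proof -
      have eq: "- w \<delta> - - (1 / sqrt 3) * \<delta> = - (w \<delta> - \<delta> / sqrt 3)" by simp
      show ?thesis unfolding eq by (rule minus_divide_left[symmetric])
    qed
    then show ?thesis using tendsto_minus[OF w2] by simp
  qed
  note asym2 = complex_branch_asymptotics[OF p2 w_plus, folded \<mu>2_def]
    and asym3 = complex_branch_asymptotics[OF p2 w_minus, folded \<mu>3_def]
  \<comment> \<open>\<open>l \<delta> - 1\<close> is of second order, so the slope is \<sigma> = 0
    and y = 1, as odd parity requires.\<close>
  have lim1: "((\<lambda>\<delta>. (\<mu>1 \<delta> - 1) / of_real \<delta>) \<longlongrightarrow> \<i> * of_real 0) (at 0)"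
    using tendsto_of_real[OF tendsto_quotient_of_square[OF l2], where ?'a = complex] by (simp add: \<mu>1_def)
  have root1: "perturbed_poly (- 1) \<delta> (\<mu>1 \<delta>) = 0" for \<delta>
    unfolding perturbed_poly_eq \<mu>1_def
    using arg_cong[OF l_root[of \<delta>], of complex_of_real] by simp
  have b1: "eigenvalue_near_circle perturbed_window \<mu>1"
    "eigenprojections_tendsto perturbed_window \<mu>1 (outer_prod v1 v1)"
    by (rule eigenvalue_branch[OF _ always_eventually lim1 _ _ _ v1_eq];
        simp add: root1 power2_eq_square)+
  have sqrt3: "sqrt 3 * sqrt 3 = 3" "1 < sqrt 3" "sqrt 3 < 2"
    by (auto intro: real_less_lsqrt)
  have \<sigma>: "0 < 1 / sqrt 3" "1 / sqrt 3 < 1" "1 / sqrt 3 * (1 / sqrt 3) = 1 / 3" "sqrt 3 = 3 * (1 / sqrt 3)"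
    using sqrt3 by (simp_all add: field_simps)
  \<comment> \<open>With q = 1 / sqrt 3 and h = sqrt 3 these evaluate (1 - \<sigma>) / (1 +
    \<sigma>) at \<sigma> = q and \<sigma> = -q.\<close>
  have y_eq: "(2 - h) * (1 + q) = 1 - q" "(2 + h) * (1 - q) = 1 + q"
    if "q * q = 1 / 3" "h = 3 * q" for q h :: real
    using that(1) unfolding that(2) by (simp_all add: algebra_simps)
  \<comment> \<open>Both 2 - sqrt 3 and 2 + sqrt 3 solve \<open>y * y = 4 * y - 1\<close>, which
    collapses the squared norm to \<open>12 * y\<close>.\<close>
  have \<kappa>: "of_real ((1 / sqrt (12 * y))\<^sup>2) * (2 * (complex_of_real (y\<^sup>2) + 1 * of_real ((y - 1)\<^sup>2) + 1)) = 1"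
    if "y * y = 4 * y - 1" "y > 0" for y :: real
  proof -
    have "(1 / sqrt (12 * y))\<^sup>2 * (2 * (y\<^sup>2 + (y - 1)\<^sup>2 + 1)) = 1"
    proof -
      have "2 * (y\<^sup>2 + (y - 1)\<^sup>2 + 1) = 12 * y"
        using that(1) by (simp add: power2_eq_square algebra_simps)
      then show ?thesis using that(2) by (simp add: power_divide)
    qed
    from arg_cong[OF this, of complex_of_real] show ?thesis by simp
  qed
  have v2: "v2 = of_real (1 / sqrt (12 * (2 - sqrt 3))) \<cdot>\<^sub>v right_vec 1 1 1 1 (of_real (2 - sqrt 3))"
    unfolding v2_def even_vec_eq[symmetric] by simp
  have v3: "v3 = of_real (1 / sqrt (12 * (2 + sqrt 3))) \<cdot>\<^sub>v right_vec 1 1 1 1 (of_real (2 + sqrt 3))"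
    unfolding v3_def even_vec_eq[symmetric] by simp
  have b2: "eigenvalue_near_circle perturbed_window \<mu>2"
    "eigenprojections_tendsto perturbed_window \<mu>2 (outer_prod v2 v2)"
  proof -
    have "1 / sqrt 3 \<noteq> - 1" "2 - sqrt 3 = (1 - 1 / sqrt 3) / (1 + 1 / sqrt 3)"
    proof -
      have "(2 - sqrt 3) * (1 + 1 / sqrt 3) = 1 - 1 / sqrt 3"
        using y_eq(1)[OF \<sigma>(3,4)] by simp
      then show "2 - sqrt 3 = (1 - 1 / sqrt 3) / (1 + 1 / sqrt 3)"
        using \<sigma>(1) by (subst eq_divide_eq) auto
    qed (use \<sigma>(1) in linarith)
    moreover have "(2 - sqrt 3) * (2 - sqrt 3) = 4 * (2 - sqrt 3) - 1" "2 - sqrt 3 > 0"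
      using sqrt3 by (auto simp: algebra_simps)
    moreover have "\<forall>\<^sub>F \<delta> in at 0. perturbed_poly 1 \<delta> (\<mu>2 \<delta>) = 0" by (simp add: even_poly)
    ultimately show "eigenvalue_near_circle perturbed_window \<mu>2"
      "eigenprojections_tendsto perturbed_window \<mu>2 (outer_prod v2 v2)"
      using eigenvalue_branch[OF _ _ asym2(1) _ _ \<kappa> v2] by blast+
  qed
  have b3: "eigenvalue_near_circle perturbed_window \<mu>3"
    "eigenprojections_tendsto perturbed_window \<mu>3 (outer_prod v3 v3)"
  proof -
    have "- (1 / sqrt 3) \<noteq> - 1" "2 + sqrt 3 = (1 - - (1 / sqrt 3)) / (1 + - (1 / sqrt 3))"
    proof -
      have "(2 + sqrt 3) * (1 + - (1 / sqrt 3)) = 1 - - (1 / sqrt 3)"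
        using y_eq(2)[OF \<sigma>(3,4)] by simp
      then show "2 + sqrt 3 = (1 - - (1 / sqrt 3)) / (1 + - (1 / sqrt 3))"
        using \<sigma>(2) by (subst eq_divide_eq) auto
    qed (use \<sigma>(2) in linarith)
    moreover have "(2 + sqrt 3) * (2 + sqrt 3) = 4 * (2 + sqrt 3) - 1" "2 + sqrt 3 > 0"
      using sqrt3 by (auto simp: algebra_simps intro: add_pos_pos)
    moreover have "\<forall>\<^sub>F \<delta> in at 0. perturbed_poly 1 \<delta> (\<mu>3 \<delta>) = 0" by (simp add: even_poly)
    ultimately show "eigenvalue_near_circle perturbed_window \<mu>3"
      "eigenprojections_tendsto perturbed_window \<mu>3 (outer_prod v3 v3)"
      using eigenvalue_branch[OF _ _ asym3(1) _ _ \<kappa> v3] by blast+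
  qed
  have o1: "(\<lambda>\<delta>. \<mu>1 \<delta> - (1 - of_real (\<delta>\<^sup>2 / 4))) \<in> o[at 0](\<lambda>\<delta>. of_real (\<delta>\<^sup>2))"
  proof (rule smallo_square)
    have "((\<lambda>\<delta>. complex_of_real ((l \<delta> - 1) / \<delta>\<^sup>2 + 1 / 4)) \<longlongrightarrow> of_real (- 1 / 4 + 1 / 4)) (at 0)"
      by (intro tendsto_intros l2)
    moreover have "\<forall>\<^sub>F \<delta> in at 0. complex_of_real ((l \<delta> - 1) / \<delta>\<^sup>2 + 1 / 4) =
        (\<mu>1 \<delta> - (1 - of_real (\<delta>\<^sup>2 / 4))) / of_real (\<delta>\<^sup>2)"
      by (auto simp: eventually_at_filter \<mu>1_def field_simps)
    ultimately show "((\<lambda>\<delta>. (\<mu>1 \<delta> - (1 - of_real (\<delta>\<^sup>2 / 4))) / of_real (\<delta>\<^sup>2)) \<longlongrightarrow> 0) (at 0)"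
      using tendsto_cong by force
  qed
  have o2: "(\<lambda>\<delta>. \<mu>2 \<delta> - (1 + \<i> * of_real (\<delta> / sqrt 3) - of_real (2 / 9 * \<delta>\<^sup>2)))
       \<in> o[at 0](\<lambda>\<delta>. of_real (\<delta>\<^sup>2))"
    using asym2(2) by simp
  have o3: "(\<lambda>\<delta>. \<mu>3 \<delta> - (1 - \<i> * of_real (\<delta> / sqrt 3) - of_real (2 / 9 * \<delta>\<^sup>2)))
       \<in> o[at 0](\<lambda>\<delta>. of_real (\<delta>\<^sup>2))"
    using asym3(2) by simp
  \<comment> \<open>An eigenvalue of modulus above 9/10 is a root of one of the cubics. The even one
    loses \<open>r \<delta>\<close>, which is close to -1/2, and the odd one its complex pair by
    \<open>norm_odd_root\<close>.\<close>
  have uniq: "\<forall>\<^sub>F \<delta> in at 0. \<nu> \<delta> \<in> {\<mu>1 \<delta>, \<mu>2 \<delta>, \<mu>3 \<delta>}"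
    if "eigenvalue_near_circle perturbed_window \<nu>" for \<nu>
  proof -
    from that have ev: "\<forall>\<^sub>F \<delta> in at 0. eigenvalue (perturbed_window \<delta>) (\<nu> \<delta>)"
      and lim: "((\<lambda>\<delta>. cmod (\<nu> \<delta>)) \<longlongrightarrow> 1) (at 0)"
      unfolding eigenvalue_near_circle_def by auto
    have "\<forall>\<^sub>F \<delta> in at 0. 9 / 10 < cmod (\<nu> \<delta>)" by (rule order_tendstoD(1)[OF lim]) simp
    moreover have "\<forall>\<^sub>F \<delta> in at 0. 9 / 10 < l \<delta>" by (rule order_tendstoD(1)[OF l1]) simp
    moreover have "\<forall>\<^sub>F \<delta> in at 0. \<bar>r \<delta>\<bar> < 9 / 10"
      by (rule order_tendstoD(2)[OF tendsto_rabs[OF r1]]) simp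
    ultimately show ?thesis using ev
    proof eventually_elim
      case (elim \<delta>)
      have "\<nu> \<delta> \<noteq> 0" using elim(1) by auto
      moreover have "exp (- \<i> * complex_of_real \<delta>) * exp (\<i> * of_real \<delta>) = 1"
        by (simp flip: exp_add)
      ultimately have "perturbed_poly 1 \<delta> (\<nu> \<delta>) = 0 \<or> perturbed_poly (- 1) \<delta> (\<nu> \<delta>) = 0"
        using eigenvalue_window_mat_imp elim(4) unfolding perturbed_window_def perturbed_poly_def by blast
      then show ?case
      proof
        assume "perturbed_poly 1 \<delta> (\<nu> \<delta>) = 0"
        moreover have "\<nu> \<delta> \<noteq> of_real (r \<delta>)" using elim(1,3) by auto
        ultimately show ?thesis by (simp add: even_poly)
      next
        assume "perturbed_poly (- 1) \<delta> (\<nu> \<delta>) = 0"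
        then have "2 * \<nu> \<delta> ^ 3 - (of_real (2 * cos \<delta>) - 1) * (\<nu> \<delta>)\<^sup>2 - 1 = 0"
          by (simp add: perturbed_poly_eq)
        from norm_odd_root[OF this l_root elim(2)] elim(1) have "\<nu> \<delta> = \<mu>1 \<delta>"
          unfolding \<mu>1_def by force
        then show ?thesis by simp
      qed
    qed
  qed
  show ?thesis
    unfolding W_hat_eq_perturbed_window[OF assms] using b1 b2 b3 o1 o2 o3 uniq by blast
qed

end
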